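(* Let $\epsilon>0$ be a constant, let $C>0$ be a constant, and let $\ell$ be any positive integer less than $\log^C n$. Consider single-pass streaming algorithms whose input is an unweighted simple graph $G=(V,E)$ with $|V|=n$ and $|E|=m$, given as a stream of $\ell\cdot n$ i.i.d. samples of the edge set of $G$ (presented in random order). Any such algorithm that outputs a $(2-\epsilon)$-approximation to the value of the maximum cut in $G$ with probability at least $99/100$ (over its internal randomness) must use $\tilde\Omega(\sqrt{n})$ space.
   Context: The maximum cut value of $G=(V,E)$ is $\mathrm{OPT}=\max_{P\cup Q=V,\,P\cap Q=\emptyset}|E\cap(P\times Q)|$. An algorithm outputs a $\gamma$-approximation (for $\gamma\ge1$) if its output lies in $[\mathrm{OPT}/\gamma,\mathrm{OPT}]$. An i.i.d. sample of the edge set of $G$ is an edge of $G$ chosen uniformly at random, independently of all other samples. Space is measured in bits. $\tilde\Omega(\cdot)$ hides factors polylogarithmic in $n$. *)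

theory Defs
  imports "HOL-Probability.Probability"
begin

text \<open>
  Graphs are simple, undirected and unweighted, on the vertex set \<open>{..<n}\<close>; an edge is an
  unordered pair, so a stream element carries no orientation.
\<close>

type_synonym edge = "nat set"

definition simple_graph :: "nat \<Rightarrow> edge set \<Rightarrow> bool" where
  "simple_graph n E \<longleftrightarrow> E \<subseteq> {e. e \<subseteq> {..<n} \<and> card e = 2}"

definition cut_value :: "edge set \<Rightarrow> nat set \<Rightarrow> nat set \<Rightarrow> nat" where
  "cut_value E P Q = card {e \<in> E. \<exists>u\<in>P. \<exists>v\<in>Q. e = {u, v}}"

definition max_cut :: "nat \<Rightarrow> edge set \<Rightarrow> nat" where
  "max_cut n E = Max {cut_value E P Q | P Q. P \<union> Q = {..<n} \<and> P \<inter> Q = {}}"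

definition is_approx :: "real \<Rightarrow> real \<Rightarrow> real \<Rightarrow> bool" where
  "is_approx \<gamma> opt x \<longleftrightarrow> opt / \<gamma> \<le> x \<and> x \<le> opt"

text \<open>
  The memory of a streaming algorithm is a bit string. All internal randomness is a random tape
  \<open>r\<close>, drawn once and independently of the stream; neither the tape nor the current position \<open>i\<close>
  in the stream is charged to the space. Access to \<open>i\<close> lets an update use a fresh part of the tape
  at every step, so algorithms tossing new coins at each update are included. Since only finitely
  many memory contents, positions and edges on \<open>n\<close> vertices are relevant, a discrete distribution
  on \<open>nat\<close> is no restriction on the tape.
\<close>

record stream_alg =
  tape :: "nat pmf"
  init :: "nat \<Rightarrow> bool list"
  update :: "nat \<Rightarrow> nat \<Rightarrow> bool list \<Rightarrow> edge \<Rightarrow> bool list"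
  result :: "nat \<Rightarrow> bool list \<Rightarrow> real"

definition uses_space :: "stream_alg \<Rightarrow> nat \<Rightarrow> bool" where
  "uses_space A s \<longleftrightarrow>
     (\<forall>r. length (init A r) = s) \<and>
     (\<forall>r i q e. length q = s \<longrightarrow> length (update A r i q e) = s)"

fun run_from :: "stream_alg \<Rightarrow> nat \<Rightarrow> nat \<Rightarrow> bool list \<Rightarrow> edge list \<Rightarrow> bool list" where
  "run_from A r i q [] = q"
| "run_from A r i q (e # es) = run_from A r (Suc i) (update A r i q e) es"

definition alg_output :: "stream_alg \<Rightarrow> nat \<Rightarrow> edge list \<Rightarrow> real" where
  "alg_output A r es = result A r (run_from A r 0 (init A r) es)"

definition iid_edge_stream :: "nat \<Rightarrow> edge set \<Rightarrow> edge list pmf" where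
  "iid_edge_stream k E = replicate_pmf k (pmf_of_set E)"

text \<open>
  The success probability is over the joint draw of the tape and of the sampled stream. Graphs
  without edges are excluded, as they admit no edge samples. The number of edges is not
  given to the algorithm.
\<close>

definition approximates_max_cut :: "stream_alg \<Rightarrow> nat \<Rightarrow> nat \<Rightarrow> real \<Rightarrow> bool" where
  "approximates_max_cut A n k \<gamma> \<longleftrightarrow>
     (\<forall>E. simple_graph n E \<and> E \<noteq> {} \<longrightarrow>
        measure_pmf.prob (pair_pmf (tape A) (iid_edge_stream k E))
          {(r, es). is_approx \<gamma> (real (max_cut n E)) (alg_output A r es)} \<ge> 99 / 100)"

end

theory Submission
  imports Defs "HOL-Real_Asymp.Real_Asymp"
begin

text \<open>
  Let \<open>h = n div 2\<close>. A set \<open>W\<close> of pairs from \<open>{..<h}\<close> determines a 2-lift of the complete graph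
  \<open>K\<^sub>h\<close>: each pair is lifted to one of the two perfect matchings between the fibres, according to
  membership in \<open>W\<close>. All these lifts have the same number of edges. If \<open>W\<close> is the edge boundary of a
  random \<open>X \<subseteq> {..<h}\<close>, the lift is bipartite; if \<open>W\<close> is uniformly random, then with high probability
  no cut contains much more than half of the edges. So the algorithm distinguishes the two cases.

  Both cases are compared with the stream of uniform samples from the union of all lifts, by
  bounding the relative entropy of the memory state. In one step the relative entropy grows by at
  most the mean squared bias of the next sample given the memory state. With \<open>s\<close> bits of memory,
  the Bonami moment bound for polynomials of degree at most 2 in random signs shows that the squared
  biases of all pairs sum to \<open>O(s\<^sup>2)\<close> on average, while there are about \<open>n\<^sup>2 / 8\<close> pairs. Over \<open>l * n\<close>
  steps the relative entropy is thus \<open>O(l * s\<^sup>2 / n)\<close>, and distinguishing requires this to be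
  \<open>\<Omega>(1)\<close>.
\<close>

subsection \<open>Moments of signed sums\<close>

text \<open>Induction on \<open>j\<close> through ratios of consecutive terms: the left ratio is the
  right one times \<open>(2k - 2j - 1) / ((2k - 1) (2j + 1))\<close>, which is at most 1. The base
  \<open>2 * k - 1\<close> becomes the constant of the two-point inequality below.\<close>

lemma choose_double_le:
  assumes "j \<le> k"
  shows "(2 * k) choose (2 * j) \<le> (k choose j) * (2 * k - 1) ^ j"
  using assms
proof (induction j)
  case 0
  show ?case by simp
next
  case (Suc j)
  have *: "((n::nat) choose Suc i) * Suc i = (n choose i) * (n - i)" for n i
  proof -
    have "Suc i * (n choose Suc i) = (n - i) * (n choose i)"
      by (simp only: binomial_absorption binomial_absorb_comp)
    then show ?thesis by (simp add: mult.commute)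
  qed
  have "(2 * k choose (2 * Suc j)) * ((2 * j + 2) * (2 * j + 1)) =
      (2 * k choose (2 * j)) * ((2 * k - 2 * j) * (2 * k - (2 * j + 1)))"
  proof -
    have "(2 * k choose (2 * Suc j)) * (2 * j + 2) = (2 * k choose (2 * j + 1)) * (2 * k - (2 * j + 1))"
      using *[of "2 * k" "2 * j + 1"] by simp
    moreover have "(2 * k choose (2 * j + 1)) * (2 * j + 1) = (2 * k choose (2 * j)) * (2 * k - 2 * j)"
      using *[of "2 * k" "2 * j"] by simp
    ultimately show ?thesis by algebra
  qed
  also have "\<dots> \<le> ((k choose j) * (2 * k - 1) ^ j) * ((2 * (k - j)) * ((2 * k - 1) * (2 * j + 1)))"
  proof (rule mult_mono)
    have "2 * k - (2 * j + 1) \<le> (2 * k - 1) * 1" by simp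
    also have "\<dots> \<le> (2 * k - 1) * (2 * j + 1)" by (intro mult_left_mono) auto
    finally show "(2 * k - 2 * j) * (2 * k - (2 * j + 1)) \<le> 2 * (k - j) * ((2 * k - 1) * (2 * j + 1))"
      by (intro mult_mono) (auto simp: diff_mult_distrib2)
  qed (use Suc in auto)
  also have "\<dots> = ((k choose Suc j) * (2 * k - 1) ^ Suc j) * ((2 * j + 2) * (2 * j + 1))"
  proof -
    have "a * P * (2 * d * (q * r)) = b * (q * P) * ((2 * j + 2) * r)"
      if "b * Suc j = a * d" for a b d P q r :: nat
    proof -
      have "a * P * (2 * d * (q * r)) = (a * d) * (2 * q * P * r)" by (simp add: mult_ac)
      also have "\<dots> = b * (q * P) * ((2 * j + 2) * r)"
        unfolding that[symmetric] by (simp add: algebra_simps)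
      finally show ?thesis .
    qed
    from this[OF *[of k j]] show ?thesis unfolding power_Suc .
  qed
  finally show ?case
    by (subst (asm) mult_le_cancel2) simp
qed

lemma power_mult_power_le_convex_comb:
  fixes x y :: real
  assumes "x \<ge> 0" "y \<ge> 0" "j \<le> k" "k > 0"
  shows "x ^ (k - j) * y ^ j \<le> (real (k - j) / real k) * x ^ k + (real j / real k) * y ^ k"
\<comment> \<open>Zero arguments are split off because \<open>0 powr 0 = 0\<close> while
  \<open>0 ^ 0 = 1\<close>, so the translation to \<open>powr\<close> would fail at
  \<open>j = 0\<close> and \<open>j = k\<close>.\<close>
proof (cases "x = 0 \<or> y = 0")
  case True
  then show ?thesis using assms by (cases "j = 0"; cases "j = k") (auto simp: zero_power)
next
  case False
  then have pos: "x > 0" "y > 0" using assms by auto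
  have "(x ^ k) powr (real (k - j) / real k) = x ^ (k - j)"
    using pos assms by (simp add: powr_powr flip: powr_realpow)
  moreover have "(y ^ k) powr (real j / real k) = y ^ j"
    using pos assms by (simp add: powr_powr flip: powr_realpow)
  ultimately show ?thesis
    using Youngs_inequality_0[of "real (k - j) / real k" "real j / real k" "x ^ k" "y ^ k"] assms pos
    by (simp add: field_simps of_nat_diff)
qed

text \<open>Hoelder's inequality with exponents \<open>k / (k - j)\<close> and \<open>k / j\<close>:
  weighted AM-GM is applied pointwise to \<open>(u x)\<^sup>2 / \<alpha>\<close> and
  \<open>(v x)\<^sup>2 / \<beta>\<close>. If \<alpha> or \<beta> is 0, this normalisation is
  impossible, but then \<open>u\<close> or \<open>v\<close> vanishes on \<open>S\<close>.\<close>

lemma sum_mixed_moment_le: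
  fixes u v :: "'a \<Rightarrow> real"
  assumes fin: "finite S" and k: "k > 0" "j \<le> k" and nonneg: "\<alpha> \<ge> 0" "\<beta> \<ge> 0" "c \<ge> 0"
    and u: "(\<Sum>x\<in>S. u x ^ (2 * k)) \<le> c * \<alpha> ^ k"
    and v: "(\<Sum>x\<in>S. v x ^ (2 * k)) \<le> c * \<beta> ^ k"
  shows "(\<Sum>x\<in>S. u x ^ (2 * (k - j)) * v x ^ (2 * j)) \<le> c * \<alpha> ^ (k - j) * \<beta> ^ j"
proof -
  have null: "w x = 0" if "(\<Sum>x\<in>S. w x ^ (2 * k)) \<le> 0" "x \<in> S" for w :: "'a \<Rightarrow> real" and x
  proof -
    have "(\<Sum>x\<in>S. w x ^ (2 * k)) = 0"
      using that by (intro antisym sum_nonneg) auto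
    then show ?thesis
      using that fin by (subst (asm) sum_nonneg_eq_0_iff) auto
  qed
  consider "j = 0" | "j = k" | "\<alpha> = 0" "0 < j" "j < k" | "\<beta> = 0" "0 < j" "j < k" | "\<alpha> > 0" "\<beta> > 0"
    using nonneg k by linarith
  then show ?thesis
  proof cases
    case 3
    then have "u x = 0" if "x \<in> S" for x using null[of u x] u k that by (simp add: zero_power)
    then show ?thesis using 3 by (simp add: zero_power)
  next
    case 4
    then have "v x = 0" if "x \<in> S" for x using null[of v x] v k that by (simp add: zero_power)
    then show ?thesis using 4 by (simp add: zero_power)
  next
    case 5
    have pt: "u x ^ (2 * (k - j)) * v x ^ (2 * j) \<le> \<alpha> ^ (k - j) * \<beta> ^ j *
        (real (k - j) / real k * (u x ^ (2 * k) / \<alpha> ^ k) + real j / real k * (v x ^ (2 * k) / \<beta> ^ k))" for x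
    proof -
      have "u x ^ (2 * (k - j)) * v x ^ (2 * j) =
          \<alpha> ^ (k - j) * \<beta> ^ j * (((u x)\<^sup>2 / \<alpha>) ^ (k - j) * ((v x)\<^sup>2 / \<beta>) ^ j)"
        using 5 by (simp add: power_mult power_divide)
      also have "\<dots> \<le> \<alpha> ^ (k - j) * \<beta> ^ j *
          (real (k - j) / real k * ((u x)\<^sup>2 / \<alpha>) ^ k + real j / real k * ((v x)\<^sup>2 / \<beta>) ^ k)"
        using 5 k by (intro mult_left_mono power_mult_power_le_convex_comb) auto
      finally show ?thesis by (simp add: power_mult power_divide)
    qed
    have "(\<Sum>x\<in>S. u x ^ (2 * (k - j)) * v x ^ (2 * j)) \<le> (\<Sum>x\<in>S. \<alpha> ^ (k - j) * \<beta> ^ j *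
        (real (k - j) / real k * (u x ^ (2 * k) / \<alpha> ^ k) + real j / real k * (v x ^ (2 * k) / \<beta> ^ k)))"
      by (intro sum_mono pt)
    also have "\<dots> = \<alpha> ^ (k - j) * \<beta> ^ j * (real (k - j) / real k * ((\<Sum>x\<in>S. u x ^ (2 * k)) / \<alpha> ^ k)
        + real j / real k * ((\<Sum>x\<in>S. v x ^ (2 * k)) / \<beta> ^ k))"
      by (simp add: sum_distrib_left sum.distrib sum_divide_distrib distrib_left)
    also have "\<dots> \<le> \<alpha> ^ (k - j) * \<beta> ^ j * (real (k - j) / real k * c + real j / real k * c)"
      using 5 u v by (intro mult_left_mono add_mono) (auto simp: field_simps)
    also have "\<dots> = c * \<alpha> ^ (k - j) * \<beta> ^ j"
      using k by (simp add: field_simps of_nat_diff)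
    finally show ?thesis .
  qed (use u v in auto)
qed

text \<open>The two-point step of Bonami's inequality: a fresh sign multiplies \<open>v\<close>.\<close>
lemma sum_even_moment_add_sign:
  fixes u v :: "'a \<Rightarrow> real"
  assumes fin: "finite S" and k: "k > 0" and nonneg: "\<alpha> \<ge> 0" "\<beta> \<ge> 0" "c \<ge> 0"
    and u: "(\<Sum>x\<in>S. u x ^ (2 * k)) \<le> c * \<alpha> ^ k"
    and v: "(\<Sum>x\<in>S. v x ^ (2 * k)) \<le> c * \<beta> ^ k"
  shows "(\<Sum>x\<in>S. (u x + v x) ^ (2 * k) + (u x - v x) ^ (2 * k))
      \<le> 2 * c * (\<alpha> + (2 * real k - 1) * \<beta>) ^ k"
proof -
  \<comment> \<open>Odd powers of \<open>b\<close> cancel between the two signs, so only binomial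
    coefficients of even index remain.\<close>
  have expand: "(a + b) ^ (2 * k) + (a - b) ^ (2 * k) =
      2 * (\<Sum>j\<le>k. real (2 * k choose (2 * j)) * (a ^ (2 * (k - j)) * b ^ (2 * j)))" for a b :: real
  proof -
    have "(a + b) ^ (2 * k) + (a - b) ^ (2 * k) =
        (\<Sum>i\<le>2 * k. real (2 * k choose i) * (b ^ i + (- b) ^ i) * a ^ (2 * k - i))"
      using binomial_ring[of b a "2 * k"] binomial_ring[of "- b" a "2 * k"]
      by (simp add: sum.distrib[symmetric] algebra_simps)
    also have "\<dots> = (\<Sum>i\<in>(\<lambda>j. 2 * j) ` {..k}. real (2 * k choose i) * (b ^ i + (- b) ^ i) * a ^ (2 * k - i))"
    proof (rule sum.mono_neutral_right)
      show "\<forall>i\<in>{..2 * k} - (*) 2 ` {..k}. real (2 * k choose i) * (b ^ i + (- b) ^ i) * a ^ (2 * k - i) = 0"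
      proof
        fix i assume i: "i \<in> {..2 * k} - (*) 2 ` {..k}"
        have "odd i"
        proof
          assume "even i"
          then obtain j where "i = 2 * j" by blast
          with i show False by auto
        qed
        then show "real (2 * k choose i) * (b ^ i + (- b) ^ i) * a ^ (2 * k - i) = 0" by simp
      qed
    qed auto
    also have "\<dots> = (\<Sum>j\<le>k. real (2 * k choose (2 * j)) * (b ^ (2 * j) + (- b) ^ (2 * j)) * a ^ (2 * k - 2 * j))"
      by (subst sum.reindex) (auto simp: inj_on_def)
    also have "\<dots> = 2 * (\<Sum>j\<le>k. real (2 * k choose (2 * j)) * (a ^ (2 * (k - j)) * b ^ (2 * j)))"
      by (subst sum_distrib_left) (rule sum.cong, auto simp: diff_mult_distrib2)
    finally show ?thesis .
  qed
  have "(\<Sum>x\<in>S. (u x + v x) ^ (2 * k) + (u x - v x) ^ (2 * k)) =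
      2 * (\<Sum>j\<le>k. real (2 * k choose (2 * j)) * (\<Sum>x\<in>S. u x ^ (2 * (k - j)) * v x ^ (2 * j)))"
    unfolding expand sum_distrib_left[symmetric]
    by (subst sum.swap) (simp add: sum_distrib_left)
  also have "\<dots> \<le> 2 * (\<Sum>j\<le>k. (real (k choose j) * (2 * real k - 1) ^ j) * (c * \<alpha> ^ (k - j) * \<beta> ^ j))"
  proof (intro mult_left_mono sum_mono mult_mono)
    fix j assume j: "j \<in> {..k}"
    have "real (2 * k choose (2 * j)) \<le> real ((k choose j) * (2 * k - 1) ^ j)"
      using choose_double_le[of j k] j by (simp only: of_nat_le_iff atMost_iff)
    also have "\<dots> = real (k choose j) * (2 * real k - 1) ^ j"
      using k by (simp add: of_nat_diff)
    finally show "real (2 * k choose (2 * j)) \<le> real (k choose j) * (2 * real k - 1) ^ j" .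
    show "(\<Sum>x\<in>S. u x ^ (2 * (k - j)) * v x ^ (2 * j)) \<le> c * \<alpha> ^ (k - j) * \<beta> ^ j"
      using j by (intro sum_mixed_moment_le assms) auto
  qed (use k in \<open>auto intro!: sum_nonneg mult_nonneg_nonneg\<close>)
  also have "\<dots> = 2 * c * (\<alpha> + (2 * real k - 1) * \<beta>) ^ k"
    using binomial_ring[of "(2 * real k - 1) * \<beta>" \<alpha> k]
    by (simp add: add.commute sum_distrib_left power_mult_distrib mult_ac)
  finally show ?thesis .
qed

text \<open>A uniformly random set stands for independent uniform signs. Members get
  \<open>- 1\<close>, so that the sign of a pair in an edge boundary is the product of its vertex
  signs.\<close>

definition sign_at :: "'a set \<Rightarrow> 'a \<Rightarrow> real" where
  "sign_at X a = (if a \<in> X then - 1 else 1)"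

lemma sum_Pow_insert:
  fixes f :: "'a set \<Rightarrow> 'b::comm_monoid_add"
  assumes "finite A" "a \<notin> A"
  shows "(\<Sum>X\<in>Pow (insert a A). f X) = (\<Sum>X\<in>Pow A. f X + f (insert a X))"
proof -
  have "inj_on (insert a) (Pow A)" using assms by (intro inj_onI) (metis Diff_insert_absorb PowD in_mono)
  then show ?thesis
    unfolding Pow_insert using assms
    by (subst sum.union_disjoint) (auto simp: sum.reindex sum.distrib)
qed

text \<open>Khintchine's inequality for even moments. In the induction the fresh sign of
  \<open>a\<close> multiplies the constant \<open>c a\<close>.\<close>

lemma sum_linear_sign_moment_le:
  fixes c :: "'a \<Rightarrow> real"
  assumes "finite A" "k > 0"
  shows "(\<Sum>X\<in>Pow A. (\<Sum>a\<in>A. c a * sign_at X a) ^ (2 * k))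
     \<le> 2 ^ card A * ((2 * real k - 1) * (\<Sum>a\<in>A. (c a)\<^sup>2)) ^ k"
  using assms(1)
proof (induction A)
  case empty
  then show ?case using assms by (simp add: zero_power)
next
  case (insert a A)
  define L where "L X = (\<Sum>b\<in>A. c b * sign_at X b)" for X
  have L_insert: "(\<Sum>b\<in>A. c b * sign_at (Set.insert a X) b) = L X" for X
    unfolding L_def using insert by (intro sum.cong) (auto simp: sign_at_def)
  have "(\<Sum>X\<in>Pow (Set.insert a A). (\<Sum>b\<in>Set.insert a A. c b * sign_at X b) ^ (2 * k)) =
      (\<Sum>X\<in>Pow A. (L X + c a) ^ (2 * k) + (L X - c a) ^ (2 * k))"
    using insert by (subst sum_Pow_insert)
      (auto simp: L_insert sign_at_def[of _ a] L_def[symmetric] add.commute intro!: sum.cong)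
  also have "\<dots> \<le> 2 * 2 ^ card A * ((2 * real k - 1) * (\<Sum>a\<in>A. (c a)\<^sup>2) + (2 * real k - 1) * (c a)\<^sup>2) ^ k"
    using insert assms
    by (intro sum_even_moment_add_sign)
      (auto simp: L_def power_mult card_Pow intro!: mult_nonneg_nonneg sum_nonneg)
  finally show ?case
    using insert by (simp add: algebra_simps)
qed

text \<open>Each edge of the complete graph occurs once, larger endpoint first, so that a new vertex
  \<open>h\<close> contributes exactly the row of pairs \<open>(h, a)\<close>.\<close>

definition vpairs :: "nat \<Rightarrow> (nat \<times> nat) set" where
  "vpairs h = Sigma {..<h} (\<lambda>b. {..<b})"

lemma finite_vpairs [simp]: "finite (vpairs h)"
  by (simp add: vpairs_def)

lemma sum_vpairs: "(\<Sum>e\<in>vpairs h. f e) = (\<Sum>b<h. \<Sum>a<b. f (b, a))"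
  by (simp add: vpairs_def sum.Sigma)

text \<open>Bonami's lemma in degree 2. The sign of the new vertex \<open>h\<close> multiplies the
  linear form \<open>L\<close>, whose moments cost one factor \<open>2 * k - 1\<close>; the
  two-point step costs another, hence the square.\<close>

lemma sum_quadratic_sign_moment_le:
  fixes c :: "nat \<times> nat \<Rightarrow> real"
  assumes "k > 0"
  shows "(\<Sum>X\<in>Pow {..<h}. (\<Sum>(b, a)\<in>vpairs h. c (b, a) * (sign_at X b * sign_at X a)) ^ (2 * k))
     \<le> 2 ^ h * ((2 * real k - 1)\<^sup>2 * (\<Sum>e\<in>vpairs h. (c e)\<^sup>2)) ^ k"
proof (induction h)
  case 0
  then show ?case using assms by (simp add: zero_power sum_vpairs)
next
  case (Suc h)
  define Q where "Q X = (\<Sum>b<h. \<Sum>a<b. c (b, a) * (sign_at X b * sign_at X a))" for X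
  define L where "L X = (\<Sum>a<h. c (h, a) * sign_at X a)" for X
  have eq: "sign_at (insert h X) a = sign_at X a" if "a < h" for a X
    using that by (simp add: sign_at_def)
  have Q_insert: "Q (insert h X) = Q X" for X
    unfolding Q_def by (intro sum.cong) (auto simp: eq)
  have L_insert: "L (insert h X) = L X" for X
    unfolding L_def by (intro sum.cong) (auto simp: eq)
  have split: "(\<Sum>(b, a)\<in>vpairs (Suc h). c (b, a) * (sign_at X b * sign_at X a)) = Q X + sign_at X h * L X" for X
    by (simp add: sum_vpairs Q_def L_def sum_distrib_left mult_ac)
  have "(\<Sum>X\<in>Pow {..<Suc h}. (\<Sum>(b, a)\<in>vpairs (Suc h). c (b, a) * (sign_at X b * sign_at X a)) ^ (2 * k)) =
      (\<Sum>X\<in>Pow {..<h}. (Q X + L X) ^ (2 * k) + (Q X - L X) ^ (2 * k))"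
    unfolding split lessThan_Suc
    by (subst sum_Pow_insert) (auto simp: L_insert Q_insert sign_at_def intro!: sum.cong)
  also have "\<dots> \<le> 2 * 2 ^ h * ((2 * real k - 1)\<^sup>2 * (\<Sum>e\<in>vpairs h. (c e)\<^sup>2)
      + (2 * real k - 1) * ((2 * real k - 1) * (\<Sum>a<h. (c (h, a))\<^sup>2))) ^ k"
    using assms Suc sum_linear_sign_moment_le[of "{..<h}" k "\<lambda>a. c (h, a)"]
    by (intro sum_even_moment_add_sign)
      (auto simp: L_def Q_def sum_vpairs intro!: mult_nonneg_nonneg sum_nonneg)
  finally show ?case
    by (simp add: sum_vpairs algebra_simps power2_eq_square)
qed

subsection \<open>Variational and level inequalities\<close>

text \<open>Gibbs' variational principle with the relative entropy to the uniform distribution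
  replaced by the larger chi-square divergence.\<close>
lemma expectation_le_ln_mean_exp:
  fixes p g :: "'a \<Rightarrow> real"
  assumes fin: "finite Z" "Z \<noteq> {}" and p: "\<And>z. z \<in> Z \<Longrightarrow> p z \<ge> 0" "(\<Sum>z\<in>Z. p z) = 1"
  shows "(\<Sum>z\<in>Z. p z * g z) \<le>
    ln ((\<Sum>z\<in>Z. exp (g z)) / real (card Z)) + (real (card Z) * (\<Sum>z\<in>Z. (p z)\<^sup>2) - 1)"
proof -
  define N where "N = real (card Z)"
  define A where "A = (\<Sum>z\<in>Z. exp (g z)) / N"
  have N: "N > 0" using fin by (simp add: N_def card_gt_0_iff)
  have A: "A > 0" using fin N by (auto simp: A_def intro!: divide_pos_pos sum_pos)
  have pt: "p z * (g z - ln A) \<le> p z * (N * p z - 1) + (exp (g z) / (A * N) - p z)" if z: "z \<in> Z" for z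
  proof (cases "p z = 0")
    case True
    then show ?thesis using A N by simp
  next
    case False
    then have pos: "p z > 0" using p(1)[OF z] by simp
    \<comment> \<open>Both logarithms are bounded by \<open>ln x \<le> x - 1\<close>: the first
      yields the chi-square term, the second a term that cancels after weighting by \<open>p\<close>
      and summing.\<close>
    have "g z - ln A = ln (N * p z) + ln (exp (g z) / (A * N * p z))"
      using pos A N by (simp add: ln_mult ln_div)
    also have "\<dots> \<le> (N * p z - 1) + (exp (g z) / (A * N * p z) - 1)"
      using pos A N by (intro add_mono ln_le_minus_one) auto
    finally have "p z * (g z - ln A) \<le> p z * ((N * p z - 1) + (exp (g z) / (A * N * p z) - 1))"
      using pos by (intro mult_left_mono) auto
    also have "\<dots> = p z * (N * p z - 1) + (p z * (exp (g z) / (A * N * p z)) - p z)"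
      by (simp add: algebra_simps)
    also have "p z * (exp (g z) / (A * N * p z)) = exp (g z) / (A * N)"
      using pos by simp
    finally show ?thesis .
  qed
  have "(\<Sum>z\<in>Z. p z * g z) - ln A = (\<Sum>z\<in>Z. p z * (g z - ln A))"
    using p(2) by (simp add: right_diff_distrib sum_subtractf sum_distrib_right[symmetric])
  also have "\<dots> \<le> (\<Sum>z\<in>Z. p z * (N * p z - 1) + (exp (g z) / (A * N) - p z))"
    by (intro sum_mono pt)
  also have "\<dots> = (\<Sum>z\<in>Z. N * (p z)\<^sup>2 + exp (g z) / (A * N) - 2 * p z)"
    by (intro sum.cong) (auto simp: algebra_simps power2_eq_square)
  also have "\<dots> = N * (\<Sum>z\<in>Z. (p z)\<^sup>2) + (\<Sum>z\<in>Z. exp (g z)) / (A * N) - 2"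
    using p(2) by (simp add: sum.distrib sum_subtractf sum_divide_distrib flip: sum_distrib_left)
  also have "(\<Sum>z\<in>Z. exp (g z)) / (A * N) = 1"
  proof -
    have "(\<Sum>z\<in>Z. exp (g z)) = A * N" using N by (simp add: A_def)
    then show ?thesis using A N by simp
  qed
  finally show ?thesis unfolding A_def N_def by simp
qed

text \<open>A level inequality: \<open>\<phi>\<close> is the indicator of an event (or a randomised version of it), and
  its correlations with the \<open>\<eta> i\<close> are bounded through their high moments.\<close>
lemma sum_correlations_power_le:
  fixes \<phi> :: "'t \<Rightarrow> real" and \<eta> :: "'i \<Rightarrow> 't \<Rightarrow> real"
  assumes fin: "finite \<Theta>" and k: "k > 0" and K: "K \<ge> 0"
    and moment: "\<And>c. (\<Sum>\<theta>\<in>\<Theta>. (\<Sum>i\<in>I. c i * \<eta> i \<theta>) ^ (2 * k)) \<le> N * (K * (\<Sum>i\<in>I. (c i)\<^sup>2)) ^ k"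
    and \<phi>: "\<And>\<theta>. \<theta> \<in> \<Theta> \<Longrightarrow> 0 \<le> \<phi> \<theta>" "\<And>\<theta>. \<theta> \<in> \<Theta> \<Longrightarrow> \<phi> \<theta> \<le> 1"
    and N: "N \<ge> 0"
  shows "(\<Sum>i\<in>I. (\<Sum>\<theta>\<in>\<Theta>. \<phi> \<theta> * \<eta> i \<theta>)\<^sup>2) ^ k \<le> N * K ^ k * (\<Sum>\<theta>\<in>\<Theta>. \<phi> \<theta>) ^ (2 * k - 1)"
proof -
  define F where "F i = (\<Sum>\<theta>\<in>\<Theta>. \<phi> \<theta> * \<eta> i \<theta>)" for i
  define W where "W = (\<Sum>i\<in>I. (F i)\<^sup>2)"
  define p where "p = (\<Sum>\<theta>\<in>\<Theta>. \<phi> \<theta>)"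
  \<comment> \<open>Duality: with the correlations \<open>F\<close> themselves as coefficients,
    \<open>W\<close> is the correlation of \<phi> with the single function \<open>G\<close>, whose
    moments are again bounded through \<open>W\<close>.\<close>
  define G where "G \<theta> = (\<Sum>i\<in>I. F i * \<eta> i \<theta>)" for \<theta>
  have p0: "p \<ge> 0" unfolding p_def using \<phi> by (intro sum_nonneg)
  have W0: "W \<ge> 0" unfolding W_def by (intro sum_nonneg) auto
  have WG: "W = (\<Sum>\<theta>\<in>\<Theta>. \<phi> \<theta> * G \<theta>)"
  proof -
    have "W = (\<Sum>i\<in>I. \<Sum>\<theta>\<in>\<Theta>. \<phi> \<theta> * (F i * \<eta> i \<theta>))"
      unfolding W_def power2_eq_square by (subst (2) F_def) (simp add: sum_distrib_left mult_ac)
    also have "\<dots> = (\<Sum>\<theta>\<in>\<Theta>. \<phi> \<theta> * G \<theta>)"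
      by (subst sum.swap) (simp add: G_def sum_distrib_left)
    finally show ?thesis .
  qed
  have "W ^ k \<le> N * K ^ k * p ^ (2 * k - 1)"
  proof (cases "p = 0 \<or> W = 0")
    case True
    have "W = 0"
    proof (cases "p = 0")
      case True
      then have "\<forall>\<theta>\<in>\<Theta>. \<phi> \<theta> = 0"
        using fin \<phi> unfolding p_def by (subst (asm) sum_nonneg_eq_0_iff) auto
      then show ?thesis by (simp add: WG)
    qed (use True in auto)
    then show ?thesis using k N K p0 by (simp add: zero_power)
  next
    case False
    then have pos: "p > 0" "W > 0" using p0 W0 by auto
    \<comment> \<open>Jensen's inequality for the weights \<open>\<phi> \<theta> / p\<close>. Then
      \<phi> \<le> 1 replaces the weighted moment of \<open>G\<close> by the full one, and a factor
      \<open>W ^ k\<close> cancels at the end.\<close>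
    have "(\<Sum>\<theta>\<in>\<Theta>. (\<phi> \<theta> / p) *\<^sub>R G \<theta>) ^ (2 * k) \<le> (\<Sum>\<theta>\<in>\<Theta>. \<phi> \<theta> / p * G \<theta> ^ (2 * k))"
      by (rule convex_on_sum[where C = UNIV and f = "\<lambda>x. x ^ (2 * k)"])
        (use pos fin \<phi> in \<open>auto intro: convex_power_even simp: p_def simp flip: sum_divide_distrib\<close>)
    also have "(\<Sum>\<theta>\<in>\<Theta>. (\<phi> \<theta> / p) *\<^sub>R G \<theta>) = W / p"
      unfolding WG by (simp add: sum_divide_distrib)
    also have "(\<Sum>\<theta>\<in>\<Theta>. \<phi> \<theta> / p * G \<theta> ^ (2 * k)) = (\<Sum>\<theta>\<in>\<Theta>. \<phi> \<theta> * G \<theta> ^ (2 * k)) / p"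
      by (simp add: sum_divide_distrib)
    also have "\<dots> \<le> (\<Sum>\<theta>\<in>\<Theta>. 1 * G \<theta> ^ (2 * k)) / p"
      using pos \<phi> by (intro divide_right_mono sum_mono mult_right_mono) auto
    also have "\<dots> \<le> N * (K * W) ^ k / p"
      using moment[of F] pos by (auto simp: G_def W_def intro!: divide_right_mono)
    finally have "(W / p) ^ (2 * k) * (p ^ (2 * k) * p) \<le> N * (K * W) ^ k / p * (p ^ (2 * k) * p)"
      using pos by (intro mult_right_mono) auto
    also have "(W / p) ^ (2 * k) * (p ^ (2 * k) * p) = W ^ k * W ^ k * p"
      using pos by (simp add: power_divide mult_2 power_add)
    also have "N * (K * W) ^ k / p * (p ^ (2 * k) * p) = N * K ^ k * W ^ k * p ^ (2 * k)"
      using pos by (simp add: power_mult_distrib)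
    also have "p ^ (2 * k) = p ^ (2 * k - 1) * p"
      using k by (metis Suc_pred' mult_pos_pos pos2 power_Suc2)
    finally have "(W ^ k) * (W ^ k * p) \<le> (N * K ^ k * p ^ (2 * k - 1)) * (W ^ k * p)"
      by (simp add: mult_ac)
    then show ?thesis using pos by (subst (asm) mult_le_cancel_right_pos) auto
  qed
  then show ?thesis by (simp add: W_def F_def p_def)
qed

text \<open>The hypothesis bounds \<open>v\<close> by a weighted geometric mean of \<open>p\<close>
  and \<open>y\<close>; passing to \<open>k\<close>-th roots makes AM-GM with integer exponents
  applicable.\<close>

lemma le_weighted_mean_of_power_le:
  fixes v p y :: real
  assumes "k > 0" "v \<ge> 0" "p \<ge> 0" "y \<ge> 0" "v ^ k \<le> p ^ (k - 1) * y"
  shows "v \<le> (real (k - 1) * p + y) / real k"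
proof -
  define x z where "x = root k p" and "z = root k y"
  have xz: "x \<ge> 0" "z \<ge> 0" "x ^ k = p" "z ^ k = y"
    using assms by (auto simp: x_def z_def)
  have "v ^ k \<le> (x ^ (k - 1) * z) ^ k"
    using assms(5) xz by (metis power_commutes power_mult power_mult_distrib mult.commute)
  then have "v \<le> x ^ (k - 1) * z"
    using assms xz by (subst (asm) power_mono_iff) auto
  also have "\<dots> \<le> real (k - 1) / real k * x ^ k + real 1 / real k * z ^ k"
    using power_mult_power_le_convex_comb[of x z 1 k] xz assms by simp
  finally show ?thesis using xz by (simp add: add_divide_distrib)
qed

text \<open>Think of \<open>\<phi> q \<theta>\<close> as the probability of memory state
  \<open>q\<close> on input \<theta>. Up to the factor \<open>card \<Theta>\<close>, each summand is
  the squared posterior bias given \<open>q\<close>, weighted by the probability of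
  \<open>q\<close>. AM-GM linearises the level inequality, so that it can be summed over the
  states.\<close>

lemma sum_posterior_correlations_le:
  fixes \<phi> :: "'q \<Rightarrow> 't \<Rightarrow> real" and \<eta> :: "'i \<Rightarrow> 't \<Rightarrow> real"
  assumes fin: "finite \<Theta>" "finite L" and k: "k > 0" "card L \<le> 2 ^ k" and K: "K > 0"
    and moment: "\<And>c. (\<Sum>\<theta>\<in>\<Theta>. (\<Sum>i\<in>I. c i * \<eta> i \<theta>) ^ (2 * k))
      \<le> real (card \<Theta>) * (K * (\<Sum>i\<in>I. (c i)\<^sup>2)) ^ k"
    and \<phi>: "\<And>q \<theta>. 0 \<le> \<phi> q \<theta>" "\<And>\<theta>. \<theta> \<in> \<Theta> \<Longrightarrow> (\<Sum>q\<in>L. \<phi> q \<theta>) = 1"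
  shows "(\<Sum>q\<in>L. (\<Sum>i\<in>I. (\<Sum>\<theta>\<in>\<Theta>. \<phi> q \<theta> * \<eta> i \<theta>)\<^sup>2) / (\<Sum>\<theta>\<in>\<Theta>. \<phi> q \<theta>)) \<le> 2 * K * real (card \<Theta>)"
proof -
  define N where "N = real (card \<Theta>)"
  define p where "p q = (\<Sum>\<theta>\<in>\<Theta>. \<phi> q \<theta>)" for q
  define W where "W q = (\<Sum>i\<in>I. (\<Sum>\<theta>\<in>\<Theta>. \<phi> q \<theta> * \<eta> i \<theta>)\<^sup>2)" for q
  have p0: "p q \<ge> 0" for q unfolding p_def using \<phi> by (intro sum_nonneg)
  have W0: "W q \<ge> 0" for q unfolding W_def by (intro sum_nonneg) auto
  have sum_p: "(\<Sum>q\<in>L. p q) = N"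
    unfolding p_def by (subst sum.swap) (simp add: \<phi>(2) N_def)
  \<comment> \<open>Dividing by \<open>2 * K\<close> turns the level inequality into a mean of
    \<open>p q\<close> and \<open>N / 2 ^ k\<close>. The \<open>p q\<close> sum to \<open>N\<close>,
    and over at most \<open>2 ^ k\<close> states the second terms sum to at most
    \<open>N\<close>.\<close>
  have pt: "W q / (2 * K * p q) \<le> (real (k - 1) * p q + N / 2 ^ k) / real k" if q: "q \<in> L" for q
  proof (cases "p q = 0")
    case True
    then show ?thesis by (simp add: N_def)
  next
    case False
    then have pos: "p q > 0" using p0[of q] by simp
    have le1: "\<phi> q \<theta> \<le> 1" if "\<theta> \<in> \<Theta>" for \<theta>
      using member_le_sum[of q L "\<lambda>q. \<phi> q \<theta>"] \<phi> fin q that by auto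
    have "W q ^ k \<le> N * K ^ k * p q ^ (2 * k - 1)"
      unfolding W_def p_def using moment fin k K \<phi> le1
      by (intro sum_correlations_power_le) (auto simp: N_def)
    also have "2 * k - 1 = (k - 1) + k" using k by simp
    finally have "(W q / (2 * K * p q)) ^ k \<le> p q ^ (k - 1) * (N / 2 ^ k)"
      using pos K by (simp add: power_divide power_mult_distrib power_add field_simps)
    then show ?thesis
      using pos K k W0 by (intro le_weighted_mean_of_power_le) (auto simp: N_def)
  qed
  have "(\<Sum>q\<in>L. W q / (2 * K * p q)) \<le> (\<Sum>q\<in>L. (real (k - 1) * p q + N / 2 ^ k) / real k)"
    by (intro sum_mono pt)
  also have "\<dots> = (real (k - 1) * N + real (card L) * (N / 2 ^ k)) / real k"
    by (simp add: sum_divide_distrib[symmetric] sum.distrib sum_distrib_left[symmetric] sum_p)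
  also have "\<dots> \<le> (real (k - 1) * N + 2 ^ k * (N / 2 ^ k)) / real k"
    using k by (intro divide_right_mono add_left_mono mult_right_mono) (auto simp: N_def)
  also have "\<dots> = N"
    using k by (simp add: field_simps of_nat_diff)
  finally have "(\<Sum>q\<in>L. W q / (2 * K * p q)) \<le> N" .
  moreover have "(\<Sum>q\<in>L. W q / p q) = 2 * K * (\<Sum>q\<in>L. W q / (2 * K * p q))"
    using K by (simp add: sum_distrib_left)
  ultimately show ?thesis using K by (simp add: W_def p_def N_def mult_left_mono)
qed

subsection \<open>Evolution of the memory state\<close>

lemma run_from_snoc:
  "run_from A r i q (es @ [e]) = update A r (i + length es) (run_from A r i q es) e"
  by (induction es arbitrary: i q) auto

text \<open>The tape \<open>r\<close> is held fixed, so the memory is a Markov chain driven by the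
  samples alone. Tapes are averaged only at the very end.\<close>

definition state_pmf :: "stream_alg \<Rightarrow> nat \<Rightarrow> edge set \<Rightarrow> nat \<Rightarrow> bool list pmf" where
  "state_pmf A r E t = map_pmf (run_from A r 0 (init A r)) (iid_edge_stream t E)"

lemma state_pmf_0: "state_pmf A r E 0 = return_pmf (init A r)"
  by (simp add: state_pmf_def iid_edge_stream_def)

lemma state_pmf_Suc:
  "state_pmf A r E (Suc t) =
     bind_pmf (state_pmf A r E t) (\<lambda>q. map_pmf (update A r t q) (pmf_of_set E))"
proof -
  have "replicate_pmf (Suc t) (pmf_of_set E) =
      bind_pmf (replicate_pmf t (pmf_of_set E)) (\<lambda>es. map_pmf (\<lambda>e. es @ [e]) (pmf_of_set E))"
    using replicate_pmf_distrib[of t 1 "pmf_of_set E"]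
    by (simp add: map_pmf_def bind_assoc_pmf bind_return_pmf)
  then show ?thesis
    unfolding state_pmf_def iid_edge_stream_def
    by (auto simp: map_bind_pmf bind_map_pmf map_pmf_comp run_from_snoc set_replicate_pmf
        intro!: bind_pmf_cong)
qed

lemma set_state_pmf_subset:
  assumes "uses_space A s"
  shows "set_pmf (state_pmf A r E t) \<subseteq> {q. length q = s}"
proof (induction t)
  case 0
  then show ?case using assms by (simp add: state_pmf_0 uses_space_def)
next
  case (Suc t)
  then show ?case using assms by (fastforce simp: state_pmf_Suc uses_space_def)
qed

lemma finite_bool_lists_length: "finite {q :: bool list. length q = s}"
  and card_bool_lists_length: "card {q :: bool list. length q = s} = 2 ^ s"
  using finite_lists_length_eq[of "UNIV :: bool set" s] card_lists_length_eq[of "UNIV :: bool set" s]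
  by auto

lemma sum_state_pmf_eq_1:
  assumes "uses_space A s"
  shows "(\<Sum>q | length q = s. pmf (state_pmf A r E t) q) = 1"
  using set_state_pmf_subset[OF assms] by (intro sum_pmf_eq_1 finite_bool_lists_length)

text \<open>The transition is moved onto the test function: a step of the chain becomes averaging
  \<open>g\<close> over the next sample. This is the form in which the chain rule substitutes for
  \<open>g\<close>.\<close>

lemma sum_state_pmf_Suc:
  fixes g :: "bool list \<Rightarrow> real"
  assumes A: "uses_space A s" and E: "finite E" "E \<noteq> {}"
  shows "(\<Sum>q | length q = s. pmf (state_pmf A r E (Suc t)) q * g q) =
    (\<Sum>q | length q = s. pmf (state_pmf A r E t) q * ((\<Sum>z\<in>E. g (update A r t q z)) / real (card E)))"
proof -
  let ?L = "{q :: bool list. length q = s}"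
  let ?N = "\<lambda>q. map_pmf (update A r t q) (pmf_of_set E)"
  have sub: "set_pmf (?N q) \<subseteq> ?L" if "q \<in> ?L" for q
    using A that by (auto simp: uses_space_def)
  have inner: "(\<Sum>q'\<in>?L. pmf (?N q) q' * g q') = (\<Sum>z\<in>E. g (update A r t q z)) / real (card E)"
    if "q \<in> ?L" for q
  proof -
    have "(\<Sum>q'\<in>?L. pmf (?N q) q' * g q') = measure_pmf.expectation (?N q) g"
      using sub[OF that]
      by (subst integral_measure_pmf[OF finite_bool_lists_length[of s]]) auto
    also have "\<dots> = (\<Sum>z\<in>E. g (update A r t q z)) / real (card E)"
      using E by (simp add: integral_pmf_of_set)
    finally show ?thesis .
  qed
  have "pmf (state_pmf A r E (Suc t)) q' = (\<Sum>q\<in>?L. pmf (state_pmf A r E t) q * pmf (?N q) q')" for q'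
    unfolding state_pmf_Suc pmf_bind using set_state_pmf_subset[OF A]
    by (subst integral_measure_pmf[OF finite_bool_lists_length[of s]]) auto
  then have "(\<Sum>q'\<in>?L. pmf (state_pmf A r E (Suc t)) q' * g q') =
      (\<Sum>q'\<in>?L. \<Sum>q\<in>?L. pmf (state_pmf A r E t) q * (pmf (?N q) q' * g q'))"
    by (simp add: sum_distrib_right mult.assoc)
  also have "\<dots> = (\<Sum>q\<in>?L. pmf (state_pmf A r E t) q * (\<Sum>q'\<in>?L. pmf (?N q) q' * g q'))"
    by (subst sum.swap) (simp add: sum_distrib_left)
  also have "\<dots> = (\<Sum>q\<in>?L. pmf (state_pmf A r E t) q * ((\<Sum>z\<in>E. g (update A r t q z)) / real (card E)))"
    by (intro sum.cong refl arg_cong2[where f = "(*)"] inner) auto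
  finally show ?thesis .
qed

text \<open>One step of the chain rule for a fixed memory state with weight \<open>\<phi>\<close>: conditioned on it, the
  next edge \<open>z\<close> has probability \<open>(1 + b z) / card Z\<close>, where \<open>b z\<close> is the posterior bias of \<open>z\<close>.\<close>
lemma posterior_step_le:
  fixes \<phi> :: "'t \<Rightarrow> real" and g :: "'z \<Rightarrow> real"
  assumes fin: "finite \<Theta>" "finite Z" and m: "m > 0" "card Z = 2 * m"
    and G: "\<And>\<theta>. \<theta> \<in> \<Theta> \<Longrightarrow> G \<theta> \<subseteq> Z" "\<And>\<theta>. \<theta> \<in> \<Theta> \<Longrightarrow> card (G \<theta>) = m"
    and \<phi>: "\<And>\<theta>. 0 \<le> \<phi> \<theta>"
  shows "(\<Sum>\<theta>\<in>\<Theta>. \<phi> \<theta> * ((\<Sum>z\<in>G \<theta>. g z) / real m)) \<le>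
    (\<Sum>\<theta>\<in>\<Theta>. \<phi> \<theta>) * ln ((\<Sum>z\<in>Z. exp (g z)) / real (card Z)) +
    (\<Sum>z\<in>Z. (\<Sum>\<theta>\<in>\<Theta>. \<phi> \<theta> * (if z \<in> G \<theta> then 1 else - 1))\<^sup>2) / (\<Sum>\<theta>\<in>\<Theta>. \<phi> \<theta>) / (2 * real m)"
proof (cases "(\<Sum>\<theta>\<in>\<Theta>. \<phi> \<theta>) = 0")
  case True
  then have "\<phi> \<theta> = 0" if "\<theta> \<in> \<Theta>" for \<theta>
    using fin \<phi> that by (subst (asm) sum_nonneg_eq_0_iff) auto
  then show ?thesis by simp
next
  case False
  define F where "F = (\<Sum>\<theta>\<in>\<Theta>. \<phi> \<theta>)"
  have F: "F > 0" using False \<phi> by (metis F_def less_eq_real_def sum_nonneg)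
  define B where "B z = (\<Sum>\<theta>\<in>\<Theta>. \<phi> \<theta> * (if z \<in> G \<theta> then 1 else - 1))" for z
  \<comment> \<open>The law of the next sample given the memory state: the posterior mixture of the
    uniform distributions on the \<open>G \<theta>\<close>.\<close>
  define p where "p z = (\<Sum>\<theta>\<in>\<Theta>. \<phi> \<theta> * (if z \<in> G \<theta> then 1 else 0)) / (F * m)" for z
  have ind: "(\<Sum>z\<in>G \<theta>. f z) = (\<Sum>z\<in>Z. (if z \<in> G \<theta> then 1 else 0) * f z)" if "\<theta> \<in> \<Theta>" for \<theta> and f :: "'z \<Rightarrow> real"
    using G(1)[OF that] fin by (simp add: if_distrib[of "\<lambda>x. x * _"] sum.If_cases Int_absorb1 cong: if_cong)
  have lhs: "(\<Sum>\<theta>\<in>\<Theta>. \<phi> \<theta> * ((\<Sum>z\<in>G \<theta>. f z) / real m)) = F * (\<Sum>z\<in>Z. p z * f z)" for f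
  proof -
    have "(\<Sum>\<theta>\<in>\<Theta>. \<phi> \<theta> * ((\<Sum>z\<in>G \<theta>. f z) / real m)) =
        (\<Sum>\<theta>\<in>\<Theta>. \<Sum>z\<in>Z. \<phi> \<theta> * (if z \<in> G \<theta> then 1 else 0) * f z / real m)"
      by (intro sum.cong) (auto simp: ind sum_distrib_left sum_divide_distrib mult.assoc)
    also have "\<dots> = (\<Sum>z\<in>Z. (\<Sum>\<theta>\<in>\<Theta>. \<phi> \<theta> * (if z \<in> G \<theta> then 1 else 0)) * f z / real m)"
      by (subst sum.swap) (simp only: sum_distrib_right sum_divide_distrib)
    also have "\<dots> = F * (\<Sum>z\<in>Z. p z * f z)"
      unfolding sum_distrib_left using F by (intro sum.cong) (auto simp: p_def)
    finally show ?thesis .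
  qed
  have sum_p: "(\<Sum>z\<in>Z. p z) = 1"
  proof -
    have "F * (\<Sum>z\<in>Z. p z * 1) = (\<Sum>\<theta>\<in>\<Theta>. \<phi> \<theta> * ((\<Sum>z\<in>G \<theta>. 1) / real m))"
      by (rule lhs[symmetric])
    also have "\<dots> = F"
      unfolding F_def using G m by (intro sum.cong) auto
    finally show ?thesis using F by simp
  qed
  have pB: "p z = (1 + B z / F) / (2 * m)" for z
  proof -
    have "B z = (\<Sum>\<theta>\<in>\<Theta>. 2 * (\<phi> \<theta> * (if z \<in> G \<theta> then 1 else 0)) - \<phi> \<theta>)"
      unfolding B_def by (intro sum.cong) auto
    also have "\<dots> = 2 * (F * m * p z) - F"
      using F m by (simp add: sum_subtractf F_def p_def flip: sum_distrib_left)
    finally show ?thesis using F m by (simp add: field_simps)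
  qed
  have chi: "real (card Z) * (\<Sum>z\<in>Z. (p z)\<^sup>2) - 1 = (\<Sum>z\<in>Z. (B z)\<^sup>2) / F\<^sup>2 / (2 * real m)"
  proof -
    have "(\<Sum>z\<in>Z. (2 * real m * p z - 1)\<^sup>2) = (\<Sum>z\<in>Z. (B z / F)\<^sup>2)"
      using m by (intro sum.cong) (auto simp: pB)
    also have "\<dots> = (\<Sum>z\<in>Z. (B z)\<^sup>2) / F\<^sup>2"
      by (simp add: power_divide sum_divide_distrib)
    also have "(\<Sum>z\<in>Z. (2 * real m * p z - 1)\<^sup>2) =
        (\<Sum>z\<in>Z. (2 * real m)\<^sup>2 * (p z)\<^sup>2 - 4 * real m * p z + 1)"
      by (intro sum.cong) (auto simp: power2_eq_square algebra_simps)
    also have "\<dots> = (2 * real m)\<^sup>2 * (\<Sum>z\<in>Z. (p z)\<^sup>2) - 4 * real m * (\<Sum>z\<in>Z. p z) + real (card Z)"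
      by (simp add: sum.distrib sum_subtractf sum_distrib_left)
    also have "\<dots> = 2 * real m * (real (card Z) * (\<Sum>z\<in>Z. (p z)\<^sup>2) - 1)"
      unfolding sum_p m by (simp add: power2_eq_square algebra_simps)
    finally have *: "2 * real m * (real (card Z) * (\<Sum>z\<in>Z. (p z)\<^sup>2) - 1) = (\<Sum>z\<in>Z. (B z)\<^sup>2) / F\<^sup>2" .
    show ?thesis unfolding *[symmetric] using m by simp
  qed
  have "(\<Sum>\<theta>\<in>\<Theta>. \<phi> \<theta> * ((\<Sum>z\<in>G \<theta>. g z) / real m)) = F * (\<Sum>z\<in>Z. p z * g z)"
    by (rule lhs)
  also have "\<dots> \<le> F * (ln ((\<Sum>z\<in>Z. exp (g z)) / real (card Z)) + (real (card Z) * (\<Sum>z\<in>Z. (p z)\<^sup>2) - 1))"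
  proof (intro mult_left_mono expectation_le_ln_mean_exp)
    show "Z \<noteq> {}" using m by auto
    show "p z \<ge> 0" for z
      unfolding p_def using F m \<phi> by (auto intro!: divide_nonneg_nonneg sum_nonneg)
  qed (use fin F sum_p in auto)
  also have "\<dots> = F * ln ((\<Sum>z\<in>Z. exp (g z)) / real (card Z)) + (\<Sum>z\<in>Z. (B z)\<^sup>2) / F / (2 * real m)"
    unfolding chi using F by (simp add: distrib_left power2_eq_square)
  finally show ?thesis unfolding F_def B_def .
qed

text \<open>The inequality \<open>\<forall>g. E\<^sub>P g \<le> ln (E\<^sub>Q exp g) + \<delta>\<close> says that the relative entropy of \<open>P\<close>
  with respect to \<open>Q\<close> is at most \<open>\<delta>\<close>. In this dual form the data processing inequality and
  the chain rule are substitutions for \<open>g\<close>. The point is that relative entropies, unlike total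
  variation distances, add up to a small quantity over all steps of the stream.\<close>
lemma state_expectation_le_ln_mean_exp:
  fixes g :: "bool list \<Rightarrow> real" and G :: "'t \<Rightarrow> edge set"
  assumes A: "uses_space A s"
    and fin: "finite \<Theta>" "\<Theta> \<noteq> {}" "finite Z" and m: "m > 0" "card Z = 2 * m"
    and G: "\<And>\<theta>. \<theta> \<in> \<Theta> \<Longrightarrow> G \<theta> \<subseteq> Z" "\<And>\<theta>. \<theta> \<in> \<Theta> \<Longrightarrow> card (G \<theta>) = m"
    and bias: "\<And>\<phi>. (\<And>q \<theta>. 0 \<le> \<phi> q \<theta>) \<Longrightarrow> (\<And>\<theta>. \<theta> \<in> \<Theta> \<Longrightarrow> (\<Sum>q | length q = s. \<phi> q \<theta>) = 1) \<Longrightarrow>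
       (\<Sum>q :: bool list | length q = s.
          (\<Sum>z\<in>Z. (\<Sum>\<theta>\<in>\<Theta>. \<phi> q \<theta> * (if z \<in> G \<theta> then 1 else - 1))\<^sup>2) / (\<Sum>\<theta>\<in>\<Theta>. \<phi> q \<theta>))
       \<le> D * real (card \<Theta>)"
  shows "(\<Sum>q | length q = s. (\<Sum>\<theta>\<in>\<Theta>. pmf (state_pmf A r (G \<theta>) t) q) / real (card \<Theta>) * g q) \<le>
    ln (\<Sum>q | length q = s. pmf (state_pmf A r Z t) q * exp (g q)) + real t * D / (2 * real m)"
proof (induction t arbitrary: g)
  case 0
  have len: "length (init A r) = s" using A by (simp add: uses_space_def)
  have delta: "(\<Sum>q | length q = s. indicat_real {q} (init A r) * f q) = f (init A r)" for f
  proof -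
    have "(\<Sum>q | length q = s. indicat_real {q} (init A r) * f q) =
        (\<Sum>q \<in> {init A r}. indicat_real {q} (init A r) * f q)"
      using len finite_bool_lists_length[of s] by (intro sum.mono_neutral_right) auto
    then show ?thesis by simp
  qed
  show ?case
    using fin by (simp add: state_pmf_0 pmf_return delta)
next
  case (Suc t)
  let ?L = "{q :: bool list. length q = s}"
  let ?n = "real (card \<Theta>)"
  define \<phi> where "\<phi> q \<theta> = pmf (state_pmf A r (G \<theta>) t) q" for q \<theta>
  \<comment> \<open>The test function for the induction hypothesis. \<open>exp (H q)\<close> is the
    mean of \<open>exp g\<close> after one step from \<open>q\<close> with a uniform sample from
    \<open>Z\<close>, so the reference term for \<open>H\<close> at time \<open>t\<close> equals
    that for \<open>g\<close> at time \<open>Suc t\<close>.\<close>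
  define H where "H q = ln ((\<Sum>z\<in>Z. exp (g (update A r t q z))) / real (card Z))" for q
  define V where "V q = (\<Sum>z\<in>Z. (\<Sum>\<theta>\<in>\<Theta>. \<phi> q \<theta> * (if z \<in> G \<theta> then 1 else - 1))\<^sup>2) / (\<Sum>\<theta>\<in>\<Theta>. \<phi> q \<theta>)" for q
  have n: "?n > 0" using fin by (simp add: card_gt_0_iff)
  have Z: "Z \<noteq> {}" using m by auto
  have finG: "finite (G \<theta>)" "G \<theta> \<noteq> {}" if "\<theta> \<in> \<Theta>" for \<theta>
    using G[OF that] m by (auto intro: card_ge_0_finite)
  have expH: "exp (H q) = (\<Sum>z\<in>Z. exp (g (update A r t q z))) / real (card Z)" for q
    unfolding H_def using Z fin m by (intro exp_ln divide_pos_pos sum_pos) auto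
  have "(\<Sum>q\<in>?L. (\<Sum>\<theta>\<in>\<Theta>. pmf (state_pmf A r (G \<theta>) (Suc t)) q) / ?n * g q) =
      (\<Sum>\<theta>\<in>\<Theta>. \<Sum>q\<in>?L. pmf (state_pmf A r (G \<theta>) (Suc t)) q * g q) / ?n"
    by (subst sum.swap) (simp add: sum_divide_distrib sum_distrib_right)
  also have "\<dots> = (\<Sum>\<theta>\<in>\<Theta>. \<Sum>q\<in>?L. \<phi> q \<theta> * ((\<Sum>z\<in>G \<theta>. g (update A r t q z)) / real m)) / ?n"
    using sum_state_pmf_Suc[OF A finG] G(2) by (simp add: \<phi>_def)
  also have "\<dots> = (\<Sum>q\<in>?L. \<Sum>\<theta>\<in>\<Theta>. \<phi> q \<theta> * ((\<Sum>z\<in>G \<theta>. g (update A r t q z)) / real m)) / ?n"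
    by (subst sum.swap) simp
  also have "\<dots> \<le> (\<Sum>q\<in>?L. (\<Sum>\<theta>\<in>\<Theta>. \<phi> q \<theta>) * H q + V q / (2 * real m)) / ?n"
    unfolding H_def V_def using n fin m G
    by (intro divide_right_mono sum_mono posterior_step_le) (auto simp: \<phi>_def)
  also have "\<dots> = (\<Sum>q\<in>?L. (\<Sum>\<theta>\<in>\<Theta>. \<phi> q \<theta>) / ?n * H q) + (\<Sum>q\<in>?L. V q) / (2 * real m) / ?n"
    by (simp add: sum.distrib add_divide_distrib flip: sum_divide_distrib)
  also have "\<dots> \<le> (ln (\<Sum>q\<in>?L. pmf (state_pmf A r Z t) q * exp (H q)) + real t * D / (2 * real m)) +
      (D * ?n) / (2 * real m) / ?n"
  proof (intro add_mono divide_right_mono)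
    show "(\<Sum>q\<in>?L. (\<Sum>\<theta>\<in>\<Theta>. \<phi> q \<theta>) / ?n * H q) \<le>
        ln (\<Sum>q\<in>?L. pmf (state_pmf A r Z t) q * exp (H q)) + real t * D / (2 * real m)"
      using Suc.IH[of H] by (simp add: \<phi>_def)
    show "sum V ?L \<le> D * ?n"
      unfolding V_def by (rule bias) (auto simp: \<phi>_def sum_state_pmf_eq_1[OF A])
  qed auto
  also have "(\<Sum>q\<in>?L. pmf (state_pmf A r Z t) q * exp (H q)) =
      (\<Sum>q\<in>?L. pmf (state_pmf A r Z (Suc t)) q * exp (g q))"
    unfolding expH by (rule sum_state_pmf_Suc[OF A fin(3) Z, symmetric])
  finally show ?case using n by (simp add: add_divide_distrib algebra_simps)
qed

text \<open>Passage from relative entropy to the probability of an event, testing with the indicator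
  of \<open>B\<close> scaled by \<open>1 / 10\<close>. The second-order error of \<open>exp\<close>
  and the entropy are each at most \<open>1 / 100\<close>; dividing by the scale, each costs
  \<open>1 / 10\<close>.\<close>

lemma mean_state_prob_le:
  fixes G :: "'t \<Rightarrow> edge set"
  assumes A: "uses_space A s"
    and fin: "finite \<Theta>" "\<Theta> \<noteq> {}" "finite Z" and m: "m > 0" "card Z = 2 * m"
    and G: "\<And>\<theta>. \<theta> \<in> \<Theta> \<Longrightarrow> G \<theta> \<subseteq> Z" "\<And>\<theta>. \<theta> \<in> \<Theta> \<Longrightarrow> card (G \<theta>) = m"
    and bias: "\<And>\<phi>. (\<And>q \<theta>. 0 \<le> \<phi> q \<theta>) \<Longrightarrow> (\<And>\<theta>. \<theta> \<in> \<Theta> \<Longrightarrow> (\<Sum>q | length q = s. \<phi> q \<theta>) = 1) \<Longrightarrow>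
       (\<Sum>q :: bool list | length q = s.
          (\<Sum>z\<in>Z. (\<Sum>\<theta>\<in>\<Theta>. \<phi> q \<theta> * (if z \<in> G \<theta> then 1 else - 1))\<^sup>2) / (\<Sum>\<theta>\<in>\<Theta>. \<phi> q \<theta>))
       \<le> D * real (card \<Theta>)"
    and small: "real t * D / (2 * real m) \<le> 1 / 100"
  shows "(\<Sum>\<theta>\<in>\<Theta>. measure_pmf.prob (state_pmf A r (G \<theta>) t) B) / real (card \<Theta>)
    \<le> measure_pmf.prob (state_pmf A r Z t) B + 1 / 5"
proof -
  let ?L = "{q :: bool list. length q = s}"
  let ?Q = "measure_pmf.prob (state_pmf A r Z t) B"
  define g :: "bool list \<Rightarrow> real" where "g q = (if q \<in> B then 1 / 10 else 0)" for q
  have prob: "measure_pmf.prob (state_pmf A r E t) B = (\<Sum>q\<in>?L. pmf (state_pmf A r E t) q * indicator B q)" for E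
  proof -
    have "measure_pmf.prob (state_pmf A r E t) B = measure_pmf.expectation (state_pmf A r E t) (indicator B)"
      by simp
    also have "\<dots> = (\<Sum>q\<in>?L. pmf (state_pmf A r E t) q * indicator B q)"
      using set_state_pmf_subset[OF A] 
      by (subst integral_measure_pmf[OF finite_bool_lists_length[of s]]) auto
    finally show ?thesis .
  qed
  have "(\<Sum>\<theta>\<in>\<Theta>. measure_pmf.prob (state_pmf A r (G \<theta>) t) B) / real (card \<Theta>) / 10 =
      (\<Sum>q\<in>?L. (\<Sum>\<theta>\<in>\<Theta>. pmf (state_pmf A r (G \<theta>) t) q) / real (card \<Theta>) * g q)"
    unfolding prob
    by (subst sum.swap, unfold sum_divide_distrib, rule sum.cong)
      (auto simp: g_def sum_divide_distrib)
  also have "\<dots> \<le> ln (\<Sum>q\<in>?L. pmf (state_pmf A r Z t) q * exp (g q)) + real t * D / (2 * real m)"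
    by (rule state_expectation_le_ln_mean_exp[OF A fin m G bias])
  also have "(\<Sum>q\<in>?L. pmf (state_pmf A r Z t) q * exp (g q)) =
      (\<Sum>q\<in>?L. pmf (state_pmf A r Z t) q + (exp (1 / 10) - 1) * (pmf (state_pmf A r Z t) q * indicator B q))"
    by (intro sum.cong) (auto simp: g_def indicator_def algebra_simps)
  also have "\<dots> = 1 + (exp (1 / 10) - 1) * ?Q"
    unfolding sum.distrib sum_state_pmf_eq_1[OF A] sum_distrib_left[symmetric] prob ..
  finally have 1: "(\<Sum>\<theta>\<in>\<Theta>. measure_pmf.prob (state_pmf A r (G \<theta>) t) B) / real (card \<Theta>) / 10 \<le>
      ln (1 + (exp (1 / 10) - 1) * ?Q) + real t * D / (2 * real m)" .
  have 2: "ln (1 + (exp (1 / 10) - 1) * ?Q) \<le> (exp (1 / 10) - 1) * ?Q"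
    by (intro ln_add_one_self_le_self) auto
  have 3: "(exp (1 / 10) - 1) * ?Q \<le> (1 / 10 + 1 / 100) * ?Q"
    using exp_bound[of "1 / 10"] by (intro mult_right_mono) (auto simp: power2_eq_square)
  have "p \<le> q + 1 / 5"
    if "p / 10 \<le> x + \<delta>" "x \<le> y" "y \<le> (1 / 10 + 1 / 100) * q" "q \<le> 1" "\<delta> \<le> 1 / 100" for p q x y \<delta> :: real
    using that by simp
  from this[OF 1 2 3 measure_pmf.prob_le_1 small] show ?thesis .
qed

subsection \<open>Signed 2-lifts of the complete graph\<close>

text \<open>The fibre over \<open>a < h\<close> is \<open>{a, a + h}\<close>; the Boolean selects
  the sheet.\<close>

definition lift_vertex :: "nat \<Rightarrow> nat \<Rightarrow> bool \<Rightarrow> nat" where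
  "lift_vertex h a i = (if i then a + h else a)"

definition lift_edge :: "nat \<Rightarrow> (nat \<times> nat) \<times> bool \<times> bool \<Rightarrow> edge" where
  "lift_edge h = (\<lambda>((b, a), (i, j)). {lift_vertex h b i, lift_vertex h a j})"

text \<open>The reference graph, with all four edges over each pair. Every signed lift contains
  exactly half of its edges.\<close>

definition full_lift :: "nat \<Rightarrow> edge set" where
  "full_lift h = lift_edge h ` (vpairs h \<times> UNIV)"

text \<open>The 2-lift of the complete graph on \<open>{..<h}\<close> that crosses exactly the pairs outside \<open>W\<close>.\<close>
definition signed_lift :: "nat \<Rightarrow> (nat \<times> nat) set \<Rightarrow> edge set" where
  "signed_lift h W = (\<lambda>(e, i). lift_edge h (e, i, i = (e \<in> W))) ` (vpairs h \<times> UNIV)"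

lemma lift_vertex_eq_iff:
  "a < h \<Longrightarrow> a' < h \<Longrightarrow> lift_vertex h a i = lift_vertex h a' i' \<longleftrightarrow> a = a' \<and> i = i'"
  by (auto simp: lift_vertex_def)

lemma inj_on_lift_edge: "inj_on (lift_edge h) (vpairs h \<times> UNIV)"
proof (rule inj_onI)
  fix x y :: "(nat \<times> nat) \<times> bool \<times> bool"
  assume xy: "x \<in> vpairs h \<times> UNIV" "y \<in> vpairs h \<times> UNIV" and eq: "lift_edge h x = lift_edge h y"
  obtain b a i j b' a' i' j' where x: "x = ((b, a), i, j)" and y: "y = ((b', a'), i', j')"
    by (metis surj_pair)
  have "a < b" "b < h" "a' < b'" "b' < h" using xy by (auto simp: x y vpairs_def)
  then show "x = y"
    using eq by (auto simp: x y lift_edge_def doubleton_eq_iff lift_vertex_eq_iff)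
qed

lemma inj_on_signed_lift: "inj_on (\<lambda>(e, i). lift_edge h (e, i, i = (e \<in> W))) (vpairs h \<times> UNIV)"
proof (rule inj_onI)
  fix x y :: "(nat \<times> nat) \<times> bool"
  assume xy: "x \<in> vpairs h \<times> UNIV" "y \<in> vpairs h \<times> UNIV"
    and eq: "(\<lambda>(e, i). lift_edge h (e, i, i = (e \<in> W))) x = (\<lambda>(e, i). lift_edge h (e, i, i = (e \<in> W))) y"
  obtain e i e' i' where x: "x = (e, i)" and y: "y = (e', i')"
    by (metis surj_pair)
  have "(e, i, i = (e \<in> W)) = (e', i', i' = (e' \<in> W))"
    using xy eq by (intro inj_onD[OF inj_on_lift_edge[of h]]) (auto simp: x y)
  then show "x = y" by (simp add: x y)
qed

lemma lift_edge_in_signed_lift_iff: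
  assumes "e \<in> vpairs h"
  shows "lift_edge h (e, i, j) \<in> signed_lift h W \<longleftrightarrow> (e \<in> W) = (i = j)"
proof
  assume "lift_edge h (e, i, j) \<in> signed_lift h W"
  then obtain e' i' where "e' \<in> vpairs h" "lift_edge h (e, i, j) = lift_edge h (e', i', i' = (e' \<in> W))"
    by (auto simp: signed_lift_def)
  then have "(e, i, j) = (e', i', i' = (e' \<in> W))"
    using assms by (intro inj_onD[OF inj_on_lift_edge[of h]]) auto
  then show "(e \<in> W) = (i = j)" by auto
next
  assume *: "(e \<in> W) = (i = j)"
  then have "lift_edge h (e, i, j) = (\<lambda>(e, i). lift_edge h (e, i, i = (e \<in> W))) (e, i)" by auto
  then show "lift_edge h (e, i, j) \<in> signed_lift h W"
    unfolding signed_lift_def using assms by (intro image_eqI) auto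
qed

lemma signed_lift_subset: "signed_lift h W \<subseteq> full_lift h"
  by (auto simp: signed_lift_def full_lift_def)

lemma finite_full_lift [simp]: "finite (full_lift h)"
  by (simp add: full_lift_def)

lemma card_full_lift: "card (full_lift h) = 2 * (2 * card (vpairs h))"
  unfolding full_lift_def by (subst card_image[OF inj_on_lift_edge]) (simp add: card_cartesian_product)

lemma card_signed_lift: "card (signed_lift h W) = 2 * card (vpairs h)"
  unfolding signed_lift_def by (subst card_image[OF inj_on_signed_lift]) (simp add: card_cartesian_product)

lemma card_vpairs: "2 * card (vpairs h) = h * (h - 1)"
proof -
  have "2 * (\<Sum>b<h. b) = h * (h - 1)"
  proof (induction h)
    case (Suc h)
    then show ?case by (cases h) (auto simp: algebra_simps)
  qed simp
  then show ?thesis by (simp add: vpairs_def)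
qed

lemma simple_graph_signed_lift:
  assumes "2 * h \<le> n"
  shows "simple_graph n (signed_lift h W)"
proof -
  have "lift_edge h ((b, a), i, j) \<subseteq> {..<n} \<and> card (lift_edge h ((b, a), i, j)) = 2"
    if "(b, a) \<in> vpairs h" for b a i j
  proof -
    have "a < b" "b < h" using that by (auto simp: vpairs_def)
    moreover from this have "lift_vertex h b i \<noteq> lift_vertex h a j"
      by (simp add: lift_vertex_eq_iff)
    ultimately show ?thesis
      using assms by (simp add: lift_edge_def card_2_iff) (auto simp: lift_vertex_def)
  qed
  then have "(\<lambda>(e, i). lift_edge h (e, i, i = (e \<in> W))) x \<in> {e. e \<subseteq> {..<n} \<and> card e = 2}"
    if "x \<in> vpairs h \<times> UNIV" for x
    using that by (cases x rule: prod.exhaust, cases "fst x") simp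
  then show ?thesis
    unfolding simple_graph_def signed_lift_def by (rule image_subsetI)
qed

text \<open>Straight edges over a pair are present iff the pair is in \<open>W \<theta>\<close>,
  crossed ones iff it is not. So the four edges over a pair share one bias up to sign, and its
  square counts four times.\<close>

lemma sum_signed_lift_bias:
  fixes \<phi> :: "'t \<Rightarrow> real"
  shows "(\<Sum>z\<in>full_lift h. (\<Sum>\<theta>\<in>\<Theta>. \<phi> \<theta> * (if z \<in> signed_lift h (W \<theta>) then 1 else - 1))\<^sup>2) =
    4 * (\<Sum>e\<in>vpairs h. (\<Sum>\<theta>\<in>\<Theta>. \<phi> \<theta> * sign_at (W \<theta>) e)\<^sup>2)"
proof -
  have pt: "(\<Sum>\<theta>\<in>\<Theta>. \<phi> \<theta> * (if lift_edge h (e, i, j) \<in> signed_lift h (W \<theta>) then 1 else - 1))\<^sup>2 =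
      (\<Sum>\<theta>\<in>\<Theta>. \<phi> \<theta> * sign_at (W \<theta>) e)\<^sup>2" if "e \<in> vpairs h" for e i j
  proof -
    have "(\<Sum>\<theta>\<in>\<Theta>. \<phi> \<theta> * (if lift_edge h (e, i, j) \<in> signed_lift h (W \<theta>) then 1 else - 1)) =
        (\<Sum>\<theta>\<in>\<Theta>. (if i = j then - 1 else 1) * (\<phi> \<theta> * sign_at (W \<theta>) e))"
      by (intro sum.cong) (auto simp: lift_edge_in_signed_lift_iff[OF that] sign_at_def)
    also have "\<dots> = (if i = j then - 1 else 1) * (\<Sum>\<theta>\<in>\<Theta>. \<phi> \<theta> * sign_at (W \<theta>) e)"
      by (rule sum_distrib_left[symmetric])
    finally show ?thesis by (simp add: power_mult_distrib)
  qed
  have "(\<Sum>z\<in>full_lift h. (\<Sum>\<theta>\<in>\<Theta>. \<phi> \<theta> * (if z \<in> signed_lift h (W \<theta>) then 1 else - 1))\<^sup>2) =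
      (\<Sum>(e, ij)\<in>vpairs h \<times> (UNIV :: (bool \<times> bool) set). (\<Sum>\<theta>\<in>\<Theta>. \<phi> \<theta> * sign_at (W \<theta>) e)\<^sup>2)"
    unfolding full_lift_def sum.reindex[OF inj_on_lift_edge] comp_def
    by (intro sum.cong) (auto simp: pt)
  also have "\<dots> = 4 * (\<Sum>e\<in>vpairs h. (\<Sum>\<theta>\<in>\<Theta>. \<phi> \<theta> * sign_at (W \<theta>) e)\<^sup>2)"
    by (simp add: sum.cartesian_product[symmetric] sum_distrib_left)
  finally show ?thesis .
qed

section \<open>Comparison of the two ensembles of lifts with the full lift\<close>

lemma mean_signed_lift_state_prob_le:
  fixes W :: "'t \<Rightarrow> (nat \<times> nat) set"
  assumes A: "uses_space A s" and fin: "finite \<Theta>" "\<Theta> \<noteq> {}" and k: "k > 0" "s \<le> k" and K: "K > 0"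
    and h: "h \<ge> 2"
    and moment: "\<And>c. (\<Sum>\<theta>\<in>\<Theta>. (\<Sum>e\<in>vpairs h. c e * sign_at (W \<theta>) e) ^ (2 * k))
      \<le> real (card \<Theta>) * (K * (\<Sum>e\<in>vpairs h. (c e)\<^sup>2)) ^ k"
    and small: "2 * real t * K / real (card (vpairs h)) \<le> 1 / 100"
  shows "(\<Sum>\<theta>\<in>\<Theta>. measure_pmf.prob (state_pmf A r (signed_lift h (W \<theta>)) t) B) / real (card \<Theta>)
    \<le> measure_pmf.prob (state_pmf A r (full_lift h) t) B + 1 / 5"
\<comment> \<open>\<open>8 * K\<close> is the bound \<open>2 * K\<close> on the posterior
  correlations times the four edges over each pair.\<close>
proof (rule mean_state_prob_le[where D = "8 * K", OF A fin finite_full_lift _ card_full_lift signed_lift_subset card_signed_lift])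
  have "h * (h - 1) > 0" using h by simp
  then show "2 * card (vpairs h) > 0" using card_vpairs[of h] by simp
  show "real t * (8 * K) / (2 * real (2 * card (vpairs h))) \<le> 1 / 100"
    using small by (simp add: field_simps)
  fix \<phi> :: "bool list \<Rightarrow> 't \<Rightarrow> real"
  assume \<phi>: "\<And>q \<theta>. 0 \<le> \<phi> q \<theta>" "\<And>\<theta>. \<theta> \<in> \<Theta> \<Longrightarrow> (\<Sum>q | length q = s. \<phi> q \<theta>) = 1"
  have "(\<Sum>q | length q = s. (\<Sum>e\<in>vpairs h. (\<Sum>\<theta>\<in>\<Theta>. \<phi> q \<theta> * sign_at (W \<theta>) e)\<^sup>2) / (\<Sum>\<theta>\<in>\<Theta>. \<phi> q \<theta>))
      \<le> 2 * K * real (card \<Theta>)"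
    by (rule sum_posterior_correlations_le[OF fin(1) finite_bool_lists_length k(1) _ K moment \<phi>])
      (use k in \<open>auto simp: card_bool_lists_length\<close>)
  moreover have "(\<Sum>q | length q = s. 4 * (\<Sum>e\<in>vpairs h. (\<Sum>\<theta>\<in>\<Theta>. \<phi> q \<theta> * sign_at (W \<theta>) e)\<^sup>2) / (\<Sum>\<theta>\<in>\<Theta>. \<phi> q \<theta>)) =
      4 * (\<Sum>q | length q = s. (\<Sum>e\<in>vpairs h. (\<Sum>\<theta>\<in>\<Theta>. \<phi> q \<theta> * sign_at (W \<theta>) e)\<^sup>2) / (\<Sum>\<theta>\<in>\<Theta>. \<phi> q \<theta>))"
    unfolding sum_distrib_left[of 4 _ "{q. length q = s}"] times_divide_eq_right ..
  ultimately show "(\<Sum>q | length q = s. (\<Sum>z\<in>full_lift h. (\<Sum>\<theta>\<in>\<Theta>. \<phi> q \<theta> *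
      (if z \<in> signed_lift h (W \<theta>) then 1 else - 1))\<^sup>2) / (\<Sum>\<theta>\<in>\<Theta>. \<phi> q \<theta>)) \<le> 8 * K * real (card \<Theta>)"
    unfolding sum_signed_lift_bias by linarith
qed

definition cut_pairs :: "nat set \<Rightarrow> (nat \<times> nat) set" where
  "cut_pairs X = {(b, a). (b \<in> X) \<noteq> (a \<in> X)}"

lemma sign_at_cut_pairs: "sign_at (cut_pairs X) (b, a) = sign_at X b * sign_at X a"
  by (simp add: sign_at_def cut_pairs_def)

lemma mean_bipartite_lift_state_prob_le:
  assumes A: "uses_space A s" and h: "h \<ge> 2"
    and small: "2 * real t * (2 * real s + 1)\<^sup>2 / real (card (vpairs h)) \<le> 1 / 100"
  shows "(\<Sum>X\<in>Pow {..<h}. measure_pmf.prob (state_pmf A r (signed_lift h (cut_pairs X)) t) B) / 2 ^ h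
    \<le> measure_pmf.prob (state_pmf A r (full_lift h) t) B + 1 / 5"
proof -
  \<comment> \<open>The moment order is \<open>2 * Suc s\<close> rather than \<open>2 * s\<close>,
    which stays positive for \<open>s = 0\<close>; the \<open>2 ^ s\<close> states are still at most
    \<open>2 ^ Suc s\<close>.\<close>
  have eq: "2 * real (Suc s) - 1 = 2 * real s + 1" by simp
  have moment: "(\<Sum>X\<in>Pow {..<h}. (\<Sum>e\<in>vpairs h. c e * sign_at (cut_pairs X) e) ^ (2 * Suc s))
      \<le> real (card (Pow {..<h})) * ((2 * real s + 1)\<^sup>2 * (\<Sum>e\<in>vpairs h. (c e)\<^sup>2)) ^ Suc s" for c :: "nat \<times> nat \<Rightarrow> real"
  proof -
    have "(\<Sum>e\<in>vpairs h. c e * sign_at (cut_pairs X) e) =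
        (\<Sum>(b, a)\<in>vpairs h. c (b, a) * (sign_at X b * sign_at X a))" for X
      by (intro sum.cong) (auto simp: sign_at_cut_pairs)
    moreover have "real (card (Pow {..<h})) = 2 ^ h" by (simp add: card_Pow)
    ultimately show ?thesis
      using sum_quadratic_sign_moment_le[where k = "Suc s" and h = h and c = c] unfolding eq
      by (simp only: zero_less_Suc)
  qed
  have "(\<Sum>X\<in>Pow {..<h}. measure_pmf.prob (state_pmf A r (signed_lift h (cut_pairs X)) t) B)
      / real (card (Pow {..<h})) \<le> measure_pmf.prob (state_pmf A r (full_lift h) t) B + 1 / 5"
    by (rule mean_signed_lift_state_prob_le[OF A _ _ _ _ _ h moment small]) auto
  then show ?thesis by (simp add: card_Pow)
qed

text \<open>The signs of all pairs are now independent, so the linear moment bound applies and only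
  the first power of \<open>2 * s + 1\<close> is lost.\<close>

lemma mean_random_lift_state_prob_le:
  assumes A: "uses_space A s" and h: "h \<ge> 2"
    and small: "2 * real t * (2 * real s + 1) / real (card (vpairs h)) \<le> 1 / 100"
  shows "(\<Sum>W\<in>Pow (vpairs h). measure_pmf.prob (state_pmf A r (signed_lift h W) t) B) / 2 ^ card (vpairs h)
    \<le> measure_pmf.prob (state_pmf A r (full_lift h) t) B + 1 / 5"
proof -
  have eq: "2 * real (Suc s) - 1 = 2 * real s + 1" by simp
  have moment: "(\<Sum>W\<in>Pow (vpairs h). (\<Sum>e\<in>vpairs h. c e * sign_at W e) ^ (2 * Suc s))
      \<le> real (card (Pow (vpairs h))) * ((2 * real s + 1) * (\<Sum>e\<in>vpairs h. (c e)\<^sup>2)) ^ Suc s" for c :: "nat \<times> nat \<Rightarrow> real"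
    using sum_linear_sign_moment_le[of "vpairs h" "Suc s" c] unfolding eq by (simp add: card_Pow)
  have "(\<Sum>W\<in>Pow (vpairs h). measure_pmf.prob (state_pmf A r (signed_lift h W) t) B)
      / real (card (Pow (vpairs h))) \<le> measure_pmf.prob (state_pmf A r (full_lift h) t) B + 1 / 5"
    by (rule mean_signed_lift_state_prob_le[OF A _ _ _ _ _ h moment small]) auto
  then show ?thesis by (simp add: card_Pow)
qed

subsection \<open>Maximum cuts of signed lifts\<close>

lemma finite_cut_values: "finite {cut_value E P Q | P Q. P \<union> Q = {..<n} \<and> P \<inter> Q = {}}"
proof -
  have "{cut_value E P Q | P Q. P \<union> Q = {..<n} \<and> P \<inter> Q = {}} \<subseteq>
      (\<lambda>(P, Q). cut_value E P Q) ` (Pow {..<n} \<times> Pow {..<n})" by auto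
  then show ?thesis by (rule finite_subset) auto
qed

lemma max_cut_ge:
  assumes "P \<union> Q = {..<n}" "P \<inter> Q = {}"
  shows "cut_value E P Q \<le> max_cut n E"
  unfolding max_cut_def using assms by (intro Max_ge finite_cut_values) auto

lemma max_cut_attained:
  obtains P Q where "P \<union> Q = {..<n}" "P \<inter> Q = {}" "max_cut n E = cut_value E P Q"
proof -
  have "{..<n} \<union> {} = {..<n}" "{..<n} \<inter> {} = {}" by auto
  then have "{cut_value E P Q | P Q. P \<union> Q = {..<n} \<and> P \<inter> Q = {}} \<noteq> {}" by blast
  from Max_in[OF finite_cut_values this] show ?thesis
    using that unfolding max_cut_def by blast
qed

text \<open>One side consists of the lower sheet over \<open>X\<close> and the upper sheet over its
  complement. A pair cut by \<open>X\<close> is lifted straight, so its endpoints share the sheet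
  and differ in \<open>X\<close>; an uncut pair is lifted crossed, with these roles exchanged. Hence
  every edge is cut.\<close>

lemma max_cut_bipartite_lift_ge:
  assumes n: "2 * h \<le> n"
  shows "2 * card (vpairs h) \<le> max_cut n (signed_lift h (cut_pairs X))"
proof -
  define P where "P = {v \<in> {..<n}. v < h \<and> v \<in> X \<or> h \<le> v \<and> v - h \<notin> X}"
  define Q where "Q = {..<n} - P"
  have side: "lift_vertex h a i < n" "lift_vertex h a i \<in> P \<longleftrightarrow> (a \<in> X) \<noteq> i" if "a < h" for a i
    using that n by (auto simp: P_def lift_vertex_def)
  have "\<exists>u\<in>P. \<exists>v\<in>Q. z = {u, v}" if z_in: "z \<in> signed_lift h (cut_pairs X)" for z
  proof -
    obtain b a i where ba: "(b, a) \<in> vpairs h"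
      and z: "z = {lift_vertex h b i, lift_vertex h a (i = ((b, a) \<in> cut_pairs X))}"
      using z_in by (auto simp: signed_lift_def lift_edge_def)
    define u v where "u = lift_vertex h b i" and "v = lift_vertex h a (i = ((b, a) \<in> cut_pairs X))"
    have "a < h" "b < h" using ba by (auto simp: vpairs_def)
    then have "u < n" "v < n" "(u \<in> P) \<noteq> (v \<in> P)"
      unfolding u_def v_def by (auto simp: side cut_pairs_def)
    moreover have "z = {u, v}" "z = {v, u}" using z by (auto simp: u_def v_def)
    ultimately show ?thesis unfolding Q_def by blast
  qed
  then have "{e \<in> signed_lift h (cut_pairs X). \<exists>u\<in>P. \<exists>v\<in>Q. e = {u, v}} = signed_lift h (cut_pairs X)"
    by blast
  then have "cut_value (signed_lift h (cut_pairs X)) P Q = 2 * card (vpairs h)"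
    by (simp add: cut_value_def card_signed_lift)
  moreover have "P \<union> Q = {..<n}" "P \<inter> Q = {}" by (auto simp: P_def Q_def)
  ultimately show ?thesis by (metis max_cut_ge)
qed

text \<open>The part of the sign of \<open>P\<close> that is odd under swapping the sheets; it is
  nonzero exactly on the fibres that \<open>P\<close> separates.\<close>

definition fiber_diff :: "nat \<Rightarrow> nat set \<Rightarrow> nat \<Rightarrow> real" where
  "fiber_diff h P a = (sign_at P a - sign_at P (a + h)) / 2"

lemma fiber_diff_bound: "\<bar>fiber_diff h P a\<bar> \<le> 1"
  by (simp add: fiber_diff_def sign_at_def)

text \<open>This is the nonnegativity of the square of \<open>\<Sum>a<h. x a\<close>,
  expanded.\<close>

lemma sum_vpairs_mult_ge:
  fixes x :: "nat \<Rightarrow> real"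
  shows "(\<Sum>(b, a)\<in>vpairs h. x b * x a) \<ge> - (\<Sum>a<h. (x a)\<^sup>2) / 2"
proof -
  have "(\<Sum>a<h. x a)\<^sup>2 = (\<Sum>a<h. (x a)\<^sup>2) + 2 * (\<Sum>(b, a)\<in>vpairs h. x b * x a)"
  proof (induction h)
    case (Suc h)
    have "(\<Sum>a<Suc h. x a)\<^sup>2 = (\<Sum>a<h. x a)\<^sup>2 + 2 * (\<Sum>a<h. x h * x a) + (x h)\<^sup>2"
      by (simp add: power2_sum sum_distrib_left mult_ac)
    then show ?case using Suc by (simp add: sum_vpairs)
  qed (simp add: sum_vpairs)
  then show ?thesis using zero_le_power2[of "\<Sum>a<h. x a"] by linarith
qed

text \<open>The sign of \<open>P\<close> on a fibre splits into its even part \<open>S\<close> and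
  its odd part \<open>fiber_diff\<close>. Summed over the two edges above a pair, mixed products
  cancel and only the product of odd parts sees \<open>W\<close>. The even quadratic form costs at
  most \<open>h / 2\<close>.\<close>

lemma cut_value_signed_lift_le:
  assumes PQ: "P \<inter> Q = {}"
  shows "real (cut_value (signed_lift h W) P Q) \<le> real (card (vpairs h)) + real h / 2 +
    (\<Sum>(b, a)\<in>vpairs h. fiber_diff h P b * fiber_diff h P a * sign_at W (b, a))"
proof -
  define f where "f = (\<lambda>(e, i). lift_edge h (e, i, i = (e \<in> W)))"
  define C where "C z \<longleftrightarrow> (\<exists>u\<in>P. \<exists>v\<in>Q. z = {u, v})" for z :: edge
  define S where "S a = (sign_at P a + sign_at P (a + h)) / 2" for a
  have cross: "of_bool (C {u, v}) \<le> (1 - sign_at P u * sign_at P v) / 2" for u v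
    using PQ by (auto simp: C_def doubleton_eq_iff sign_at_def)
  have pt: "(\<Sum>i\<in>UNIV. of_bool (C (f ((b, a), i)))) \<le>
      1 - S b * S a + fiber_diff h P b * fiber_diff h P a * sign_at W (b, a)" for b a
  proof -
    have "(\<Sum>i\<in>UNIV. of_bool (C (f ((b, a), i)))) \<le>
       (\<Sum>i\<in>UNIV. (1 - sign_at P (lift_vertex h b i) * sign_at P (lift_vertex h a (i = ((b, a) \<in> W)))) / 2)"
      by (intro sum_mono) (simp only: f_def lift_edge_def prod.case cross)
    also have "\<dots> = 1 - S b * S a + fiber_diff h P b * fiber_diff h P a * sign_at W (b, a)"
      by (cases "(b, a) \<in> W")
        (simp_all add: UNIV_bool lift_vertex_def S_def fiber_diff_def sign_at_def[of W] field_simps)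
    finally show ?thesis .
  qed
  have "cut_value (signed_lift h W) P Q = card (f ` {x \<in> vpairs h \<times> UNIV. C (f x)})"
    unfolding cut_value_def signed_lift_def f_def[symmetric] C_def[symmetric]
    by (rule arg_cong[where f = card]) auto
  also have "\<dots> \<le> card {x \<in> vpairs h \<times> UNIV. C (f x)}"
    by (intro card_image_le) simp
  also have "real \<dots> = (\<Sum>x\<in>vpairs h \<times> UNIV. of_bool (C (f x)))"
    by (simp add: of_bool_def sum.If_cases Int_def conj_commute)
  also have "\<dots> = (\<Sum>e\<in>vpairs h. \<Sum>i\<in>UNIV. of_bool (C (f (e, i))))"
    unfolding sum.cartesian_product by (intro sum.cong) auto
  also have "\<dots> \<le> (\<Sum>(b, a)\<in>vpairs h. 1 - S b * S a + fiber_diff h P b * fiber_diff h P a * sign_at W (b, a))"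
    using pt by (intro sum_mono) (auto split: prod.splits)
  also have "\<dots> = real (card (vpairs h)) - (\<Sum>(b, a)\<in>vpairs h. S b * S a) +
      (\<Sum>(b, a)\<in>vpairs h. fiber_diff h P b * fiber_diff h P a * sign_at W (b, a))"
    by (simp add: split_beta sum.distrib sum_subtractf)
  also have "\<dots> \<le> real (card (vpairs h)) + real h / 2 +
      (\<Sum>(b, a)\<in>vpairs h. fiber_diff h P b * fiber_diff h P a * sign_at W (b, a))"
  proof -
    have "(\<Sum>a<h. (S a)\<^sup>2) \<le> (\<Sum>a<h. 1)"
      by (intro sum_mono) (auto simp: S_def sign_at_def)
    then show ?thesis using sum_vpairs_mult_ge[where h = h and x = S] by simp
  qed
  finally show ?thesis by simp
qed

text \<open>Markov's inequality for the moment of order \<open>2 * h\<close> is strong enough to beat the union bound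
  over the \<open>2 ^ n\<close> cuts.\<close>
lemma few_lifts_with_large_cut:
  assumes h: "h \<ge> 2" and n: "n \<le> 2 * h + 1" and \<delta>: "\<delta> > 0" and large: "3200 / \<delta>\<^sup>2 \<le> real (h - 1)"
  defines "M \<equiv> card (vpairs h)"
  shows "real (card {W \<in> Pow (vpairs h). \<exists>P\<subseteq>{..<n}.
      (\<Sum>(b, a)\<in>vpairs h. fiber_diff h P b * fiber_diff h P a * sign_at W (b, a)) \<ge> \<delta> * real M}) \<le> 2 ^ M / 100"
proof -
  define T where "T P W = (\<Sum>(b, a)\<in>vpairs h. fiber_diff h P b * fiber_diff h P a * sign_at W (b, a))" for P W
  have M2: "2 * real M = real h * real (h - 1)"
    using card_vpairs[of h] by (metis M_def of_nat_mult of_nat_numeral)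
  have "real h * real (h - 1) > 0" using h by simp
  then have M: "real M > 0" using M2 by linarith
  \<comment> \<open>The factor \<open>1 / 800\<close> leaves room for the union bound: at most
    \<open>2 * 4 ^ h\<close> cuts give \<open>2 * (1 / 200) ^ h\<close>, which is at most
    \<open>1 / 100\<close>.\<close>
  have single: "real (card {W \<in> Pow (vpairs h). T P W \<ge> \<delta> * M}) \<le> 2 ^ M * (1 / 800) ^ h" for P
  proof -
    define c where "c e = fiber_diff h P (fst e) * fiber_diff h P (snd e)" for e
    have T: "T P W = (\<Sum>e\<in>vpairs h. c e * sign_at W e)" for W
      by (simp add: T_def c_def split_beta)
    have "(c e)\<^sup>2 \<le> 1" for e
      using fiber_diff_bound[of h P "fst e"] fiber_diff_bound[of h P "snd e"]
      by (simp add: c_def abs_square_le_1 abs_mult mult_le_one)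
    then have c: "(\<Sum>e\<in>vpairs h. (c e)\<^sup>2) \<le> real M"
      using sum_mono[of "vpairs h" "\<lambda>e. (c e)\<^sup>2" "\<lambda>_. 1"] by (simp add: M_def)
    have "real (card {W \<in> Pow (vpairs h). T P W \<ge> \<delta> * M}) * (\<delta> * M) ^ (2 * h) =
        (\<Sum>W\<in>{W \<in> Pow (vpairs h). T P W \<ge> \<delta> * M}. (\<delta> * M) ^ (2 * h))" by simp
    also have "\<dots> \<le> (\<Sum>W\<in>{W \<in> Pow (vpairs h). T P W \<ge> \<delta> * M}. T P W ^ (2 * h))"
      using \<delta> M by (intro sum_mono power_mono) auto
    also have "\<dots> \<le> (\<Sum>W\<in>Pow (vpairs h). T P W ^ (2 * h))"
      by (intro sum_mono2) auto
    also have "\<dots> \<le> 2 ^ M * ((2 * real h - 1) * (\<Sum>e\<in>vpairs h. (c e)\<^sup>2)) ^ h"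
      unfolding T M_def using h by (intro sum_linear_sign_moment_le) auto
    also have "\<dots> \<le> 2 ^ M * ((2 * real h) * M) ^ h"
      using h c by (intro mult_left_mono power_mono mult_mono) (auto intro!: sum_nonneg mult_nonneg_nonneg)
    also have "\<dots> \<le> 2 ^ M * ((\<delta> * M)\<^sup>2 * (1 / 800)) ^ h"
    proof (intro mult_left_mono power_mono)
      \<comment> \<open>The constant is \<open>4 * 800\<close>: one factor 2 comes from the moment
        bound \<open>2 * h * M\<close>, the other from \<open>2 * M = h * (h - 1)\<close>.\<close>
      have "3200 \<le> \<delta>\<^sup>2 * real (h - 1)"
        using large \<delta> h by (simp add: divide_le_eq mult.commute of_nat_diff)
      then have "real h * 3200 \<le> real h * (\<delta>\<^sup>2 * real (h - 1))"
        by (rule mult_left_mono[OF _ of_nat_0_le_iff])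
      also have "\<dots> = \<delta>\<^sup>2 * (2 * real M)" unfolding M2 by simp
      finally have "2 * real h \<le> \<delta>\<^sup>2 * real M * (1 / 800)" by (simp add: mult.commute)
      then have "2 * real h * M \<le> \<delta>\<^sup>2 * real M * (1 / 800) * M"
        using M by (intro mult_right_mono) auto
      then show "2 * real h * M \<le> (\<delta> * M)\<^sup>2 * (1 / 800)"
        by (simp add: power2_eq_square mult_ac)
    qed (use h in auto)
    also have "\<dots> = (2 ^ M * (1 / 800) ^ h) * (\<delta> * M) ^ (2 * h)"
      unfolding power_mult_distrib[of "(\<delta> * M)\<^sup>2" "1 / 800"] power_mult[of "\<delta> * M" 2 h] by simp
    finally show ?thesis
      using \<delta> M by (subst (asm) mult_le_cancel_right_pos) auto
  qed
  have "{W \<in> Pow (vpairs h). \<exists>P\<subseteq>{..<n}. T P W \<ge> \<delta> * M} = (\<Union>P\<in>Pow {..<n}. {W \<in> Pow (vpairs h). T P W \<ge> \<delta> * M})"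
    by auto
  then have "real (card {W \<in> Pow (vpairs h). \<exists>P\<subseteq>{..<n}. T P W \<ge> \<delta> * M}) \<le>
      real (\<Sum>P\<in>Pow {..<n}. card {W \<in> Pow (vpairs h). T P W \<ge> \<delta> * M})"
    unfolding of_nat_le_iff by (simp only: card_UN_le finite_Pow_iff finite_lessThan)
  also have "\<dots> = (\<Sum>P\<in>Pow {..<n}. real (card {W \<in> Pow (vpairs h). T P W \<ge> \<delta> * M}))"
    by simp
  also have "\<dots> \<le> (\<Sum>P\<in>Pow {..<n}. 2 ^ M * (1 / 800) ^ h)"
    by (intro sum_mono single)
  also have "\<dots> = 2 ^ n * (2 ^ M * (1 / 800) ^ h)"
    by (simp add: card_Pow)
  also have "\<dots> \<le> 2 ^ (2 * h + 1) * (2 ^ M * (1 / 800) ^ h)"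
    using n by (intro mult_right_mono power_increasing) auto
  also have "\<dots> = 2 ^ M * (2 * (4 * (1 / 800)) ^ h)"
    unfolding power_mult_distrib power_add power_mult by simp
  also have "\<dots> \<le> 2 ^ M * (2 * (1 / 200) ^ 1)"
    using h power_decreasing[of 1 h "1 / 200 :: real"] by (intro mult_left_mono) auto
  finally show ?thesis by (simp add: T_def)
qed

lemma max_cut_signed_lift_less:
  assumes "\<And>P. P \<subseteq> {..<n} \<Longrightarrow>
      (\<Sum>(b, a)\<in>vpairs h. fiber_diff h P b * fiber_diff h P a * sign_at W (b, a)) < x"
  shows "real (max_cut n (signed_lift h W)) < real (card (vpairs h)) + real h / 2 + x"
proof -
  obtain P Q where PQ: "P \<union> Q = {..<n}" "P \<inter> Q = {}"
    "max_cut n (signed_lift h W) = cut_value (signed_lift h W) P Q"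
    by (rule max_cut_attained)
  then have "P \<subseteq> {..<n}" by auto
  from assms[OF this] cut_value_signed_lift_le[OF PQ(2), of h W] PQ(3) show ?thesis by simp
qed

subsection \<open>The lower bound\<close>

lemma prob_pair_pmf:
  "measure_pmf.prob (pair_pmf p q) S = measure_pmf.expectation p (\<lambda>x. measure_pmf.prob q {y. (x, y) \<in> S})"
proof -
  have "ennreal (measure_pmf.prob (pair_pmf p q) S) = (\<integral>\<^sup>+x. indicator S x \<partial>pair_pmf p q)"
    by (simp add: measure_pmf.emeasure_eq_measure)
  also have "\<dots> = (\<integral>\<^sup>+x. \<integral>\<^sup>+y. indicator {y. (x, y) \<in> S} y \<partial>q \<partial>p)"
    unfolding nn_integral_pair_pmf' by (intro nn_integral_cong) (auto simp: indicator_def)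
  also have "\<dots> = (\<integral>\<^sup>+x. ennreal (measure_pmf.prob q {y. (x, y) \<in> S}) \<partial>p)"
    by (simp add: measure_pmf.emeasure_eq_measure)
  also have "\<dots> = ennreal (measure_pmf.expectation p (\<lambda>x. measure_pmf.prob q {y. (x, y) \<in> S}))"
    by (intro nn_integral_eq_integral measure_pmf.integrable_const_bound[where B = 1]) auto
  finally show ?thesis
    by (subst (asm) ennreal_inj) (auto intro!: integral_nonneg_AE)
qed

lemma prob_alg_output:
  "measure_pmf.prob (pair_pmf (tape A) (iid_edge_stream t E)) {(r, es). R (alg_output A r es)} =
   measure_pmf.expectation (tape A) (\<lambda>r. measure_pmf.prob (state_pmf A r E t) {q. R (result A r q)})"
  unfolding prob_pair_pmf state_pmf_def measure_map_pmf
  by (simp add: alg_output_def vimage_def)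

text \<open>For each tape, acceptance of bipartite lifts and rejection of random ones exceed the
  corresponding probabilities on the full lift by at most \<open>1 / 5\<close> on average. Those two
  add up to 1, so the total is at most \<open>7 / 5\<close>. Correctness would force
  \<open>99 / 100 + (99 / 100)\<^sup>2\<close>, the second factor of the square being the share of
  lifts outside \<open>Bad\<close>.\<close>

lemma no_distinguishing_threshold:
  fixes x :: real
  assumes A: "uses_space A s" and h: "h \<ge> 2"
    and small: "2 * real t * (2 * real s + 1)\<^sup>2 / real (card (vpairs h)) \<le> 1 / 100"
    and yes: "\<And>X. X \<subseteq> {..<h} \<Longrightarrow> measure_pmf.prob (pair_pmf (tape A)
      (iid_edge_stream t (signed_lift h (cut_pairs X)))) {(r, es). x \<le> alg_output A r es} \<ge> 99 / 100"
    and bad: "real (card Bad) \<le> 2 ^ card (vpairs h) / 100" "Bad \<subseteq> Pow (vpairs h)"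
    and no: "\<And>W. W \<in> Pow (vpairs h) - Bad \<Longrightarrow> measure_pmf.prob (pair_pmf (tape A)
      (iid_edge_stream t (signed_lift h W))) {(r, es). \<not> x \<le> alg_output A r es} \<ge> 99 / 100"
  shows False
proof -
  let ?M = "card (vpairs h)"
  define f where "f E r = measure_pmf.prob (state_pmf A r E t) {q. x \<le> result A r q}" for E r
  define g where "g E r = measure_pmf.prob (state_pmf A r E t) {q. \<not> x \<le> result A r q}" for E r
  have int [simp]: "integrable (measure_pmf (tape A)) (f E)" "integrable (measure_pmf (tape A)) (g E)" for E
    unfolding f_def g_def by (intro measure_pmf.integrable_const_bound[where B = 1]; simp)+
  have small': "2 * real t * (2 * real s + 1) / real ?M \<le> 1 / 100"
  proof -
    have "(2 * real s + 1) * 1 \<le> (2 * real s + 1) * (2 * real s + 1)"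
      by (intro mult_left_mono) auto
    then have "2 * real t * (2 * real s + 1) / real ?M \<le> 2 * real t * (2 * real s + 1)\<^sup>2 / real ?M"
      by (intro divide_right_mono mult_left_mono) (auto simp: power2_eq_square)
    then show ?thesis using small by linarith
  qed
  have le: "(\<Sum>X\<in>Pow {..<h}. f (signed_lift h (cut_pairs X)) r) / 2 ^ h +
      (\<Sum>W\<in>Pow (vpairs h). g (signed_lift h W) r) / 2 ^ ?M \<le> 7 / 5" for r
  proof -
    have "measure_pmf.prob (state_pmf A r (full_lift h) t) {q. x \<le> result A r q} +
        measure_pmf.prob (state_pmf A r (full_lift h) t) {q. \<not> x \<le> result A r q} = 1"
      using measure_pmf.prob_compl[of "{q. x \<le> result A r q}" "state_pmf A r (full_lift h) t"]
      by (simp add: Compl_eq_Diff_UNIV[symmetric] Collect_neg_eq[symmetric])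
    then show ?thesis
      using mean_bipartite_lift_state_prob_le[OF A h small, of r "{q. x \<le> result A r q}"]
        mean_random_lift_state_prob_le[OF A h small', of r "{q. \<not> x \<le> result A r q}"]
      unfolding f_def g_def by linarith
  qed
  have "measure_pmf.expectation (tape A) (\<lambda>r. (\<Sum>X\<in>Pow {..<h}. f (signed_lift h (cut_pairs X)) r) / 2 ^ h +
      (\<Sum>W\<in>Pow (vpairs h). g (signed_lift h W) r) / 2 ^ ?M) \<le> 7 / 5"
    by (intro measure_pmf.integral_le_const AE_I2 le Bochner_Integration.integrable_add
        Bochner_Integration.integrable_divide_zero Bochner_Integration.integrable_sum int)
  also have "measure_pmf.expectation (tape A) (\<lambda>r. (\<Sum>X\<in>Pow {..<h}. f (signed_lift h (cut_pairs X)) r) / 2 ^ h +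
      (\<Sum>W\<in>Pow (vpairs h). g (signed_lift h W) r) / 2 ^ ?M) =
      (\<Sum>X\<in>Pow {..<h}. measure_pmf.expectation (tape A) (f (signed_lift h (cut_pairs X)))) / 2 ^ h +
      (\<Sum>W\<in>Pow (vpairs h). measure_pmf.expectation (tape A) (g (signed_lift h W))) / 2 ^ ?M"
    by (simp add: Bochner_Integration.integral_add Bochner_Integration.integral_sum
        Bochner_Integration.integrable_divide Bochner_Integration.integrable_sum)
  finally have total: "(\<Sum>X\<in>Pow {..<h}. measure_pmf.expectation (tape A) (f (signed_lift h (cut_pairs X)))) / 2 ^ h +
      (\<Sum>W\<in>Pow (vpairs h). measure_pmf.expectation (tape A) (g (signed_lift h W))) / 2 ^ ?M \<le> 7 / 5" .
  have "(\<Sum>X\<in>Pow {..<h}. 99 / 100) \<le>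
      (\<Sum>X\<in>Pow {..<h}. measure_pmf.expectation (tape A) (f (signed_lift h (cut_pairs X))))"
    using yes unfolding prob_alg_output f_def by (intro sum_mono) auto
  then have Y: "99 / 100 \<le> (\<Sum>X\<in>Pow {..<h}. measure_pmf.expectation (tape A) (f (signed_lift h (cut_pairs X)))) / 2 ^ h"
    by (simp add: card_Pow field_simps)
  have finBad: "finite Bad" using bad(2) by (rule finite_subset) simp
  have "real (card (Pow (vpairs h) - Bad)) = 2 ^ ?M - real (card Bad)"
    using card_Diff_subset[OF finBad bad(2)] card_mono[OF _ bad(2)] by (simp add: card_Pow of_nat_diff)
  then have "99 / 100 * 2 ^ ?M * (99 / 100) \<le> (\<Sum>W\<in>Pow (vpairs h) - Bad. 99 / 100 :: real)"
    using bad(1) by simp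
  also have "\<dots> \<le> (\<Sum>W\<in>Pow (vpairs h) - Bad. measure_pmf.expectation (tape A) (g (signed_lift h W)))"
    using no unfolding prob_alg_output[where R = "\<lambda>y. \<not> x \<le> y"] g_def by (intro sum_mono) auto
  also have "\<dots> \<le> (\<Sum>W\<in>Pow (vpairs h). measure_pmf.expectation (tape A) (g (signed_lift h W)))"
    by (intro sum_mono2) (auto simp: g_def intro!: integral_nonneg_AE)
  finally have "99 / 100 * (99 / 100) \<le> (\<Sum>W\<in>Pow (vpairs h). measure_pmf.expectation (tape A) (g (signed_lift h W))) / 2 ^ ?M"
    by (simp add: field_simps)
  with Y total show False by linarith
qed

text \<open>The constant is \<open>16 * 200\<close>: there are at least
  \<open>n\<^sup>2 / 16\<close> pairs, and the entropy bound asks for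
  \<open>200 * l * n * (2 * s + 1)\<^sup>2\<close> to be at most their number.\<close>

lemma samples_times_space_squared_gt:
  fixes \<epsilon> :: real
  assumes \<epsilon>: "\<epsilon> > 0" "2 - \<epsilon> \<ge> 1" and A: "uses_space A s"
    and approx: "approximates_max_cut A n (l * n) (2 - \<epsilon>)"
    and n: "real n \<ge> 500000 / \<epsilon>\<^sup>2"
  shows "real l * (2 * real s + 1)\<^sup>2 > real n / 3200"
proof (rule ccontr)
  assume "\<not> ?thesis"
  then have le: "real l * (2 * real s + 1)\<^sup>2 \<le> real n / 3200" by simp
  define h where "h = n div 2"
  define M where "M = card (vpairs h)"
  \<comment> \<open>The separating threshold: bipartite lifts have optimum at least
    \<open>2 * M\<close>, so valid outputs reach \<open>x\<close>, whereas lifts outside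
    \<open>Bad\<close> have optimum below \<open>x\<close>.\<close>
  define x where "x = 2 * real M / (2 - \<epsilon>)"
  have n_h: "2 * h \<le> n" "n \<le> 2 * h + 1" unfolding h_def by linarith+
  have "\<epsilon>\<^sup>2 \<le> 1" using \<epsilon> by (simp add: power_le_one)
  then have eps_ge: "1 / \<epsilon>\<^sup>2 \<ge> 1" using \<epsilon> by simp
  \<comment> \<open>Here \<open>204800 = 3200 * 8\<^sup>2\<close>, as the bad lifts are counted with
    \<delta> = \<epsilon> / 8. The bound \<open>n \<ge> 8\<close> serves to absorb the rounding in
    \<open>h\<close> when comparing \<open>M\<close> with \<open>n\<^sup>2\<close>.\<close>
  have h1: "real (h - 1) \<ge> 204800 / \<epsilon>\<^sup>2" and n8: "n \<ge> 8"
  proof -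
    have "real n \<le> 2 * real h + 1" using n_h(2) by linarith
    moreover have "real h \<le> real (h - 1) + 1" by simp
    ultimately show "real (h - 1) \<ge> 204800 / \<epsilon>\<^sup>2" using n eps_ge by simp
    have "real n \<ge> 8" using n eps_ge by linarith
    then show "n \<ge> 8" by simp
  qed
  have h2: "h \<ge> 2" using n8 n_h by simp
  have M2: "2 * real M = real h * real (h - 1)"
    using card_vpairs[of h] by (metis M_def of_nat_mult of_nat_numeral)
  have M16: "16 * real M \<ge> (real n)\<^sup>2"
  proof -
    have "8 * (2 * real M) \<ge> 8 * (((real n - 1) / 2) * ((real n - 3) / 2))"
      unfolding M2 using n_h(2) n8 h2 by (intro mult_left_mono mult_mono) (auto simp: of_nat_diff)
    moreover have "real n * real n \<ge> 8 * real n" using n8 by (intro mult_right_mono) auto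
    ultimately show ?thesis by (simp add: power2_eq_square field_simps)
  qed
  have "real h * real (h - 1) > 0" using h2 by simp
  then have Mpos: "real M > 0" using M2 by linarith
  have small: "2 * real (l * n) * (2 * real s + 1)\<^sup>2 / real (card (vpairs h)) \<le> 1 / 100"
  proof -
    have "200 * (real l * (2 * real s + 1)\<^sup>2) * real n \<le> 200 * (real n / 3200) * real n"
      using le by (intro mult_right_mono mult_left_mono) auto
    also have "\<dots> \<le> real M" using M16 by (simp add: power2_eq_square)
    finally show ?thesis using Mpos by (simp add: M_def field_simps)
  qed
  define Bad where "Bad = {W \<in> Pow (vpairs h). \<exists>P\<subseteq>{..<n}.
      (\<Sum>(b, a)\<in>vpairs h. fiber_diff h P b * fiber_diff h P a * sign_at W (b, a)) \<ge> \<epsilon> / 8 * real M}"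
  have bad: "real (card Bad) \<le> 2 ^ card (vpairs h) / 100"
    unfolding Bad_def M_def using h1 \<epsilon>
    by (intro few_lifts_with_large_cut h2 n_h) (auto simp: power_divide)
  have success: "measure_pmf.prob (pair_pmf (tape A) (iid_edge_stream (l * n) (signed_lift h W)))
      {(r, es). is_approx (2 - \<epsilon>) (real (max_cut n (signed_lift h W))) (alg_output A r es)} \<ge> 99 / 100" for W
  proof -
    have "card (signed_lift h W) > 0" using Mpos by (simp add: card_signed_lift M_def)
    then have "signed_lift h W \<noteq> {}" by auto
    then show ?thesis
      using approx simple_graph_signed_lift[OF n_h(1), of W] unfolding approximates_max_cut_def by blast
  qed
  show False
  proof (rule no_distinguishing_threshold[OF A h2 small _ bad])
    show "Bad \<subseteq> Pow (vpairs h)" by (auto simp: Bad_def)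
  next
    fix X assume "X \<subseteq> {..<h}"
    let ?E = "signed_lift h (cut_pairs X)"
    have "x \<le> real (max_cut n ?E) / (2 - \<epsilon>)"
      using max_cut_bipartite_lift_ge[OF n_h(1), of X] \<epsilon> unfolding x_def M_def
      by (intro divide_right_mono) auto
    then have sub: "{(r, es). is_approx (2 - \<epsilon>) (real (max_cut n ?E)) (alg_output A r es)}
        \<subseteq> {(r, es). x \<le> alg_output A r es}"
      by (auto simp: is_approx_def)
    show "measure_pmf.prob (pair_pmf (tape A) (iid_edge_stream (l * n) ?E)) {(r, es). x \<le> alg_output A r es} \<ge> 99 / 100"
      by (rule order_trans[OF success measure_pmf.finite_measure_mono[OF sub]]) simp
  next
    fix W assume W: "W \<in> Pow (vpairs h) - Bad"
    have "real (max_cut n (signed_lift h W)) < real M + real h / 2 + \<epsilon> / 8 * real M"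
      unfolding M_def
    proof (rule max_cut_signed_lift_less)
      fix P assume "P \<subseteq> {..<n}"
      with W show "(\<Sum>(b, a)\<in>vpairs h. fiber_diff h P b * fiber_diff h P a * sign_at W (b, a))
          < \<epsilon> / 8 * real (card (vpairs h))"
        unfolding Bad_def M_def by (metis (no_types, lifting) DiffD1 DiffD2 mem_Collect_eq not_le)
    qed
    also have "\<dots> \<le> x"
    proof -
      \<comment> \<open>The slack is shared: \<open>h / 2\<close> is at most
        \<open>\<epsilon> / 8 * M\<close> once \<open>\<epsilon> * (h - 1) \<ge> 8\<close>, and
        \<open>(1 + \<epsilon> / 4) * (2 - \<epsilon>)\<close> is at most 2.\<close>
      have "8 / \<epsilon> \<le> 204800 / \<epsilon>\<^sup>2"
        using \<epsilon> by (simp add: field_simps power2_eq_square)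
      then have "8 / \<epsilon> \<le> real (h - 1)" using h1 by linarith
      then have "8 \<le> \<epsilon> * real (h - 1)" using \<epsilon> by (metis pos_divide_le_eq mult.commute)
      then have "real h * 8 \<le> real h * (\<epsilon> * real (h - 1))"
        by (rule mult_left_mono[OF _ of_nat_0_le_iff])
      also have "\<dots> = \<epsilon> * (2 * real M)" unfolding M2 by simp
      finally have "real M + real h / 2 + \<epsilon> / 8 * real M \<le> (1 + \<epsilon> / 4) * real M"
        by (simp add: algebra_simps)
      also have "\<dots> \<le> x"
      proof -
        have "(1 + \<epsilon> / 4) * (2 - \<epsilon>) * real M \<le> 2 * real M"
          using \<epsilon> by (intro mult_right_mono) (auto simp: algebra_simps)
        then show ?thesis using \<epsilon> unfolding x_def by (subst pos_le_divide_eq) (auto simp: mult_ac)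
      qed
      finally show ?thesis .
    qed
    finally have sub: "{(r, es). is_approx (2 - \<epsilon>) (real (max_cut n (signed_lift h W))) (alg_output A r es)}
        \<subseteq> {(r, es). \<not> x \<le> alg_output A r es}"
      by (auto simp: is_approx_def)
    show "measure_pmf.prob (pair_pmf (tape A) (iid_edge_stream (l * n) (signed_lift h W)))
        {(r, es). \<not> x \<le> alg_output A r es} \<ge> 99 / 100"
      by (rule order_trans[OF success measure_pmf.finite_measure_mono[OF sub]]) simp
  qed
qed

theorem theorem2:
  fixes \<epsilon> C :: real
  assumes "\<epsilon> > 0" and "2 - \<epsilon> \<ge> 1" and "C > 0"
  shows "\<exists>c > 0. \<exists>k N :: nat. \<forall>n \<ge> N. \<forall>l :: nat.
           0 < l \<and> real l < log 2 (real n) powr C \<longrightarrow>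
           (\<forall>A s. uses_space A s \<and> approximates_max_cut A n (l * n) (2 - \<epsilon>) \<longrightarrow>
              real s \<ge> c * sqrt (real n) / log 2 (real n) ^ k)"
proof -
  \<comment> \<open>Since \<open>l\<close> is below \<open>L powr C\<close> with
    \<open>L = log 2 n\<close>, the space bound loses a factor \<open>L powr (C / 2)\<close>; any
    natural \<open>k \<ge> C / 2\<close> dominates it.\<close>
  define k where "k = nat \<lceil>C\<rceil>"
  have k: "C \<le> real (2 * k)" unfolding k_def using assms(3) by linarith
  have "eventually (\<lambda>n::nat. log 2 (real n) powr C \<le> real n / 20000 \<and>
      real n \<ge> 500000 / \<epsilon>\<^sup>2 \<and> n \<ge> 2) at_top"
    using assms(3) by (intro eventually_conj eventually_ge_at_top) (real_asymp, real_asymp)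
  then obtain N where N: "\<And>n. n \<ge> N \<Longrightarrow> log 2 (real n) powr C \<le> real n / 20000"
      "\<And>n. n \<ge> N \<Longrightarrow> real n \<ge> 500000 / \<epsilon>\<^sup>2" "\<And>n. n \<ge> N \<Longrightarrow> n \<ge> 2"
    unfolding eventually_at_top_linorder by blast
  have "real s \<ge> 1 / 200 * sqrt (real n) / log 2 (real n) ^ k"
    if "n \<ge> N" and l: "real l < log 2 (real n) powr C"
      and alg: "uses_space A s" "approximates_max_cut A n (l * n) (2 - \<epsilon>)" for n l A s
  proof (rule ccontr)
    define L where "L = log 2 (real n)"
    assume "\<not> ?thesis"
    then have s: "real s < 1 / 200 * sqrt (real n) / L ^ k" by (simp add: L_def)
    have L: "L \<ge> 1" using N(3)[OF \<open>n \<ge> N\<close>] by (simp add: L_def)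
    have "real l * (real s)\<^sup>2 \<le> L ^ (2 * k) * (1 / 200 * sqrt (real n) / L ^ k)\<^sup>2"
    proof (intro mult_mono power_mono)
      have "real l \<le> L powr C" using l by (simp add: L_def)
      also have "\<dots> \<le> L powr real (2 * k)" using L k by (intro powr_mono)
      also have "\<dots> = L ^ (2 * k)" using L by (intro powr_realpow) auto
      finally show "real l \<le> L ^ (2 * k)" .
    qed (use s L in auto)
    also have "\<dots> = real n / 40000"
      using L by (simp add: power_divide power_mult_distrib power_mult power2_eq_square power_even_eq)
    \<comment> \<open>The constants fit because
      \<open>8 / 200\<^sup>2 + 2 / 20000 = 3 / 10000 < 1 / 3200\<close>; the second summand pays for
      the \<open>+ 1\<close> in \<open>2 * s + 1\<close>.\<close>
    finally have "8 * (real l * (real s)\<^sup>2) \<le> real n / 5000" by simp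
    moreover have "real l * 2 \<le> real n / 10000" using l N(1)[OF \<open>n \<ge> N\<close>] by simp
    moreover have "real l * (2 * real s + 1)\<^sup>2 \<le> real l * (8 * (real s)\<^sup>2 + 2)"
    proof (rule mult_left_mono[OF _ of_nat_0_le_iff])
      have "0 \<le> (2 * real s - 1)\<^sup>2" by simp
      then show "(2 * real s + 1)\<^sup>2 \<le> 8 * (real s)\<^sup>2 + 2"
        by (simp add: power2_eq_square algebra_simps)
    qed
    moreover have "real l * (2 * real s + 1)\<^sup>2 > real n / 3200"
      by (rule samples_times_space_squared_gt[OF assms(1,2) alg N(2)[OF \<open>n \<ge> N\<close>]])
    moreover have "real n > 0" using N(3)[OF \<open>n \<ge> N\<close>] by simp
    ultimately show False by (simp add: algebra_simps)
  qed
  then show ?thesis by (intro exI[of _ "1 / 200"] conjI exI[of _ k] exI[of _ N]) auto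
qed

end
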